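(* Let $\kappa>-1$ be real and let $\rho>-1$ be a non-integer real number. For $s\in\mathbb{Z}$ let $A^{\kappa,\rho}_s(\mathbb{D})$ be the closure in $L^{2,\kappa}_\rho(\mathbb{D})$ of the linear span of $\{\bar z^{-s/2}\mathcal{Z}^{\kappa,\rho-s/2}_{m,m+s/2}:\ m=0,1,2,\dots\}$. Then the Hilbert spaces $A^{\kappa,\rho}_s(\mathbb{D})$, $s\in\mathbb{Z}$, define a Hilbertian orthogonal decomposition of $L^{2,\kappa}_\rho(\mathbb{D})$, namely $$L^{2,\kappa}_\rho(\mathbb{D})=\bigoplus_{s\in\mathbb{Z}}A^{\kappa,\rho}_s(\mathbb{D}).$$
   Context: Let $\mathbb{D}=\{z\in\mathbb{C}:|z|<1\}$ and $\mathbb{D}^*=\mathbb{D}\setminus\{0\}$; $\partial/\partial z$ is the Wirtinger derivative. $L^{2,\kappa}_\rho(\mathbb{D})$ is the Hilbert space of complex-valued functions on $\mathbb{D}$ square integrable with respect to $(1-|z|^2)^\kappa|z|^{2\rho}\,dx\,dy$ ($z=x+iy$). The fractional Zernike functions on $\mathbb{D}^*$ are given by $$\mathcal{Z}^{\kappa,\rho}_{m,n}(z,\bar z)=(-1)^m z^{-\rho}(1-|z|^2)^{-\kappa}\frac{\partial^m}{\partial z^m}\Big(z^{n+\rho}(1-|z|^2)^{\kappa+m}\Big),$$ the powers of $z$ being taken with the same local branch. The same formula is used to define $\mathcal{Z}^{\kappa,\rho-s/2}_{m,m+s/2}$, which gives $\mathcal{Z}^{\kappa,\rho-s/2}_{m,m+s/2}=z^{s/2}\mathcal{Z}^{\kappa,\rho}_{m,m}$;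 with compatible branches of $z^{s/2}$ and $\bar z^{-s/2}$, $\bar z^{-s/2}\mathcal{Z}^{\kappa,\rho-s/2}_{m,m+s/2}$ is the single-valued function $z^s|z|^{-s}\mathcal{Z}^{\kappa,\rho}_{m,m}(z,\bar z)$. The symbol $\bigoplus$ denotes the Hilbert space (completed) orthogonal direct sum. *)

theory Defs
  imports "HOL-Analysis.Analysis" "HOL-Library.Function_Algebras"
begin

section \<open>Square-integrable functions and Hilbert sums\<close>

text \<open>
  Elements of \<open>L\<^sup>2(M)\<close> are represented by functions. The norm below is therefore
  only a seminorm, and equality of elements of the Hilbert space is equality almost
  everywhere.
\<close>

definition l2_space :: "'a measure \<Rightarrow> ('a \<Rightarrow> complex) set" where
  "l2_space M = {f \<in> borel_measurable M. integrable M (\<lambda>x. (cmod (f x))\<^sup>2)}"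

definition l2_inner :: "'a measure \<Rightarrow> ('a \<Rightarrow> complex) \<Rightarrow> ('a \<Rightarrow> complex) \<Rightarrow> complex" where
  "l2_inner M f g = (\<integral>x. f x * cnj (g x) \<partial>M)"

definition l2_norm :: "'a measure \<Rightarrow> ('a \<Rightarrow> complex) \<Rightarrow> real" where
  "l2_norm M f = sqrt (\<integral>x. (cmod (f x))\<^sup>2 \<partial>M)"

definition fun_scale :: "complex \<Rightarrow> ('a \<Rightarrow> complex) \<Rightarrow> 'a \<Rightarrow> complex" where
  "fun_scale c f = (\<lambda>x. c * f x)"

interpretation cfun: vector_space "fun_scale :: complex \<Rightarrow> ('a \<Rightarrow> complex) \<Rightarrow> 'a \<Rightarrow> complex"
  by standard (auto simp: fun_scale_def fun_eq_iff algebra_simps)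

text \<open>
  The intersection with \<open>l2_space M\<close> only matters for sets not contained in
  \<open>L\<^sup>2(M)\<close>: for a function outside, the Bochner integral in \<open>l2_norm\<close> has a junk value.
\<close>
definition l2_closure :: "'a measure \<Rightarrow> ('a \<Rightarrow> complex) set \<Rightarrow> ('a \<Rightarrow> complex) set" where
  "l2_closure M S =
    {f \<in> l2_space M. \<forall>\<epsilon>>0. \<exists>g \<in> S \<inter> l2_space M. l2_norm M (\<lambda>x. f x - g x) < \<epsilon>}"

definition l2_closed_subspace :: "'a measure \<Rightarrow> ('a \<Rightarrow> complex) set \<Rightarrow> bool" where
  "l2_closed_subspace M S \<longleftrightarrow> S \<subseteq> l2_space M \<and> cfun.subspace S \<and> l2_closure M S = S"

text \<open>Unconditional convergence in norm, in analogy to \<open>has_sum\<close>.\<close>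
definition l2_has_sum ::
  "'a measure \<Rightarrow> ('i \<Rightarrow> 'a \<Rightarrow> complex) \<Rightarrow> 'i set \<Rightarrow> ('a \<Rightarrow> complex) \<Rightarrow> bool" where
  "l2_has_sum M g I f \<longleftrightarrow>
    ((\<lambda>F. l2_norm M (\<lambda>x. f x - (\<Sum>i\<in>F. g i x))) \<longlongrightarrow> 0) (finite_subsets_at_top I)"

text \<open>
  \<open>L\<^sup>2(M)\<close> is the (completed) orthogonal direct sum of the family \<open>A\<close> of closed subspaces:
  the family is pairwise orthogonal, and summation is a norm-preserving bijection (up to
  equality almost everywhere) from the Hilbert space of families \<open>(g\<^sub>i)\<close> with \<open>g\<^sub>i \<in> A\<^sub>i\<close> and
  \<open>\<Sum>\<^sub>i \<parallel>g\<^sub>i\<parallel>\<^sup>2 < \<infinity>\<close> onto \<open>L\<^sup>2(M)\<close>.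
\<close>
definition l2_orthogonal_decomposition ::
  "'a measure \<Rightarrow> 'i set \<Rightarrow> ('i \<Rightarrow> ('a \<Rightarrow> complex) set) \<Rightarrow> bool" where
  "l2_orthogonal_decomposition M I A \<longleftrightarrow>
    (\<forall>i\<in>I. l2_closed_subspace M (A i)) \<and>
    (\<forall>i\<in>I. \<forall>j\<in>I. i \<noteq> j \<longrightarrow> (\<forall>f\<in>A i. \<forall>g\<in>A j. l2_inner M f g = 0)) \<and>
    (\<forall>g. (\<forall>i\<in>I. g i \<in> A i) \<and> (\<lambda>i. (l2_norm M (g i))\<^sup>2) summable_on I \<longrightarrow>
      (\<exists>f\<in>l2_space M. l2_has_sum M g I f)) \<and>
    (\<forall>f\<in>l2_space M. \<exists>g. (\<forall>i\<in>I. g i \<in> A i) \<and> l2_has_sum M g I f \<and>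
      ((\<lambda>i. (l2_norm M (g i))\<^sup>2) has_sum (l2_norm M f)\<^sup>2) I \<and>
      (\<forall>h. (\<forall>i\<in>I. h i \<in> A i) \<and> l2_has_sum M h I f \<longrightarrow>
        (\<forall>i\<in>I. AE x in M. h i x = g i x)))"


section \<open>Fractional Zernike functions\<close>

definition zernike_measure :: "real \<Rightarrow> real \<Rightarrow> complex measure" where
  "zernike_measure \<kappa> \<rho> =
    density (restrict_space lborel (ball 0 1))
      (\<lambda>z. ennreal ((1 - (cmod z)\<^sup>2) powr \<kappa> * cmod z powr (2 * \<rho>)))"

text \<open>\<open>\<partial>/\<partial>z = (\<partial>/\<partial>x - \<i> \<partial>/\<partial>y) / 2\<close>\<close>
definition wirtinger :: "(complex \<Rightarrow> complex) \<Rightarrow> complex \<Rightarrow> complex" where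
  "wirtinger f z =
    (frechet_derivative f (at z) 1 - \<i> * frechet_derivative f (at z) \<i>) / 2"

text \<open>
  The branch of \<open>w \<mapsto> w\<^sup>a\<close> near \<open>z\<close> (\<open>z \<noteq> 0\<close>): \<open>Ln z + Ln (w / z)\<close> is a logarithm of \<open>w\<close>
  that is holomorphic in \<open>w\<close> near \<open>z\<close>, also for \<open>z\<close> on the branch cut of the principal
  logarithm \<open>Ln\<close>.
\<close>
definition local_power :: "complex \<Rightarrow> real \<Rightarrow> complex \<Rightarrow> complex" where
  "local_power z a w = exp (of_real a * (Ln z + Ln (w / z)))"

text \<open>
  The second index is real, since half-integral values \<open>m + s/2\<close> are needed. For an
  integral second index the value does not depend on the branch of the powers.
\<close>
definition zernike :: "real \<Rightarrow> real \<Rightarrow> nat \<Rightarrow> real \<Rightarrow> complex \<Rightarrow> complex" where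
  "zernike \<kappa> \<rho> m n z =
    (-1) ^ m * local_power z (- \<rho>) z * of_real ((1 - (cmod z)\<^sup>2) powr (- \<kappa>)) *
    (wirtinger ^^ m)
      (\<lambda>w. local_power z (n + \<rho>) w * of_real ((1 - (cmod w)\<^sup>2) powr (\<kappa> + real m))) z"

text \<open>
  The compatible branch of the power of the conjugate variable is the conjugate of the power
  of \<open>z\<close>. The value at \<open>z = 0\<close> is immaterial.
\<close>
definition zernike_gen :: "real \<Rightarrow> real \<Rightarrow> int \<Rightarrow> nat \<Rightarrow> complex \<Rightarrow> complex" where
  "zernike_gen \<kappa> \<rho> s m z =
    cnj (local_power z (- (of_int s / 2)) z) *
    zernike \<kappa> (\<rho> - of_int s / 2) m (real m + of_int s / 2) z"

lemma zernike_gen_eq: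
  assumes "z \<noteq> 0"
  shows "zernike_gen \<kappa> \<rho> s m z =
    z powi s * of_real (cmod z powr (- of_int s)) * zernike \<kappa> \<rho> m (real m) z"
proof -
  define L where "L = Ln z"
  have eL: "exp L = z" using assms by (simp add: L_def)
  have pow: "local_power z a z = exp (of_real a * L)" for a
    using assms by (simp add: local_power_def L_def)
  have "Re L = ln (cmod z)" using assms by (simp add: L_def)
  then have L_cnj: "L + cnj L = of_real (2 * ln (cmod z))"
    by (simp add: complex_eq_iff)
  have "cnj (local_power z (- (of_int s / 2)) z) * local_power z (- (\<rho> - of_int s / 2)) z
      = exp (- of_real (of_int s / 2) * cnj L) * exp (- of_real (\<rho> - of_int s / 2) * L)"
    by (simp only: pow exp_cnj [symmetric]) (simp add: exp_cnj)
  also have "\<dots> = exp (of_int s * L - of_real (of_int s / 2) * (L + cnj L) - of_real \<rho> * L)"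
    by (simp add: exp_add [symmetric] algebra_simps) (simp add: field_simps)
  also have "\<dots> = exp (of_int s * L) * exp (of_real (- of_int s * ln (cmod z)))
                  * exp (- of_real \<rho> * L)"
    unfolding L_cnj by (simp add: exp_add [symmetric] algebra_simps)
  also have "exp (of_int s * L) = z powi s"
    using exp_power_int [of L s] by (simp add: eL mult.commute)
  also have "exp (of_real (- of_int s * ln (cmod z))) =
      (of_real (cmod z powr (- of_int s)) :: complex)"
    using assms by (simp only: exp_of_real powr_def) simp
  also have "exp (- of_real \<rho> * L) = local_power z (- \<rho>) z"
    by (simp add: pow)
  finally have *: "cnj (local_power z (- (of_int s / 2)) z) *
      local_power z (- (\<rho> - of_int s / 2)) z =
      z powi s * of_real (cmod z powr (- of_int s)) * local_power z (- \<rho>) z" .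
  have swap: "a * (x * b * y * w) = p * (x * q * y * w)"
    if "a * b = p * q" for a b p q x y w :: complex
  proof -
    have "a * (x * b * y * w) = (a * b) * (x * y * w)" by (simp only: mult_ac)
    also have "\<dots> = p * (x * q * y * w)" unfolding that by (simp only: mult_ac)
    finally show ?thesis .
  qed
  have idx: "real m + of_int s / 2 + (\<rho> - of_int s / 2) = real m + \<rho>" by simp
  show ?thesis
    unfolding zernike_gen_def zernike_def idx by (rule swap [OF *])
qed

definition zernike_subspace :: "real \<Rightarrow> real \<Rightarrow> int \<Rightarrow> (complex \<Rightarrow> complex) set" where
  "zernike_subspace \<kappa> \<rho> s =
    l2_closure (zernike_measure \<kappa> \<rho>) (cfun.span (range (zernike_gen \<kappa> \<rho> s)))"

end

theory Submission
  imports Defs "HOL-Computational_Algebra.Polynomial"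
begin

text \<open>
  On the punctured disc the generators of the \<open>s\<close>-th space have the form
  \<open>(z/\<bar>z\<bar>)\<^sup>s P\<^sub>m(\<bar>z\<bar>\<^sup>2)\<close> with a real polynomial \<open>P\<^sub>m\<close>, because \<open>\<partial>/\<partial>z\<close> maps products of a
  holomorphic power and a function of \<open>t = \<bar>z\<bar>\<^sup>2\<close> to products of the same kind
  (\<open>wirtinger_power_Rodrigues\<close>). The leading coefficient of \<open>P\<^sub>m\<close> is a product of factors
  \<open>2 m + \<rho> + \<kappa> - i\<close> with \<open>i < m\<close>, all positive for \<open>\<kappa>, \<rho> > -1\<close>. So \<open>P\<^sub>m\<close> has degree exactly
  \<open>m\<close>, the span of the generators consists of all \<open>(z/\<bar>z\<bar>)\<^sup>s p(\<bar>z\<bar>\<^sup>2)\<close> with \<open>p\<close> a polynomial,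
  and by Weierstrass its closure contains all \<open>(z/\<bar>z\<bar>)\<^sup>s c(\<bar>z\<bar>\<^sup>2)\<close> with \<open>c\<close> continuous
  (\<open>angular_mode_continuous_in_subspace\<close>).

  Two facts remain. The spaces are pairwise orthogonal since the measure is invariant under
  rotations, while a rotation by \<open>\<alpha>\<close> multiplies functions in the \<open>s\<close>-th space by
  \<open>exp(\<i> s \<alpha>)\<close> (\<open>angular_modes_orthogonal\<close>). Together they are total: finite sums of
  functions \<open>(z/\<bar>z\<bar>)\<^sup>s c(\<bar>z\<bar>\<^sup>2)\<close> form, away from \<open>0\<close>, an algebra that contains \<open>Re z\<close> and \<open>Im z\<close>, hence all
  polynomials in two real variables; these are uniformly dense in the continuous functions on
  the closed disc, and these are dense in \<open>L\<^sup>2\<close> because the measure is finite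
  (\<open>zernike_subspaces_total\<close>). Finiteness comes down to a Beta integral, as the area measure
  in the variable \<open>t = \<bar>z\<bar>\<^sup>2\<close> is \<open>\<pi> dt\<close>.

  The rest is Hilbert space theory, valid for every measure: \<open>L\<^sup>2\<close> is complete, and a total
  family of pairwise orthogonal closed subspaces decomposes it
  (\<open>orthogonal_decomposition_if_total\<close>). The orthogonal projection to a summand is
  the limit of the components in this summand of approximating finite sums.
\<close>

section \<open>Square-integrable functions\<close>

lemma sum_fun_apply: "(\<Sum>i\<in>F. (g i :: 'a \<Rightarrow> complex)) x = (\<Sum>i\<in>F. g i x)"
  by (induction F rule: infinite_finite_induct) auto

lemma l2_spaceD:
  assumes "f \<in> l2_space M"
  shows "f \<in> borel_measurable M" and "integrable M (\<lambda>x. (cmod (f x))\<^sup>2)"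
  using assms by (auto simp: l2_space_def)

lemma l2_spaceI_bound:
  assumes "f \<in> borel_measurable M" "integrable M w" "AE x in M. (cmod (f x))\<^sup>2 \<le> w x"
  shows "f \<in> l2_space M"
proof -
  have "integrable M (\<lambda>x. (cmod (f x))\<^sup>2)"
    by (rule Bochner_Integration.integrable_bound[OF assms(2)])
      (use assms in \<open>auto elim!: eventually_mono\<close>)
  then show ?thesis using assms(1) by (simp add: l2_space_def)
qed

lemma cmod_add_sq_le: "(cmod (a + b))\<^sup>2 \<le> 2 * (cmod a)\<^sup>2 + 2 * (cmod b)\<^sup>2"
proof -
  have "(cmod (a + b))\<^sup>2 \<le> (cmod a + cmod b)\<^sup>2"
    by (intro power_mono norm_triangle_ineq) auto
  also have "\<dots> \<le> 2 * (cmod a)\<^sup>2 + 2 * (cmod b)\<^sup>2"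
    using sum_squares_bound[of "cmod a" "cmod b"] by (simp add: power2_sum)
  finally show ?thesis .
qed

lemma l2_space_add:
  assumes "f \<in> l2_space M" "g \<in> l2_space M"
  shows "f + g \<in> l2_space M"
proof (rule l2_spaceI_bound)
  show "integrable M (\<lambda>x. 2 * (cmod (f x))\<^sup>2 + 2 * (cmod (g x))\<^sup>2)"
    using assms by (simp add: l2_spaceD)
  have "f \<in> borel_measurable M" "g \<in> borel_measurable M"
    using assms by (auto dest: l2_spaceD)
  then show "f + g \<in> borel_measurable M"
    unfolding plus_fun_def by measurable
qed (use cmod_add_sq_le in auto)

lemma l2_space_scale:
  assumes "f \<in> l2_space M"
  shows "fun_scale c f \<in> l2_space M"
proof (rule l2_spaceI_bound)
  show "integrable M (\<lambda>x. (cmod c)\<^sup>2 * (cmod (f x))\<^sup>2)"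
    using assms by (auto dest: l2_spaceD)
  show "fun_scale c f \<in> borel_measurable M"
    unfolding fun_scale_def using l2_spaceD[OF assms] by measurable
qed (auto simp: fun_scale_def norm_mult power_mult_distrib)

lemma subspace_l2_space: "cfun.subspace (l2_space M)"
  by (rule cfun.subspaceI) (auto simp: l2_space_add l2_space_scale, simp add: l2_space_def zero_fun_def)

lemma l2_space_diff:
  assumes "f \<in> l2_space M" "g \<in> l2_space M"
  shows "f - g \<in> l2_space M"
  using cfun.subspace_diff[OF subspace_l2_space assms] .

lemma l2_space_AE_cong:
  assumes "f \<in> l2_space M" "g \<in> borel_measurable M" "AE x in M. f x = g x"
  shows "g \<in> l2_space M"
  using assms(1) by (intro l2_spaceI_bound[OF assms(2), where w = "\<lambda>x. (cmod (f x))\<^sup>2"])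
    (use assms(3) in \<open>auto dest: l2_spaceD elim: eventually_mono\<close>)

lemma l2_norm_nonneg [simp]: "0 \<le> l2_norm M f"
  by (simp add: l2_norm_def)

lemma l2_norm_sq: "(l2_norm M f)\<^sup>2 = (\<integral>x. (cmod (f x))\<^sup>2 \<partial>M)"
  by (simp add: l2_norm_def)

lemma l2_norm_zero [simp]: "l2_norm M 0 = 0"
  by (simp add: l2_norm_def)

lemma l2_norm_scale: "l2_norm M (fun_scale c f) = cmod c * l2_norm M f"
  by (simp add: l2_norm_def fun_scale_def norm_mult power_mult_distrib real_sqrt_mult)

lemma l2_norm_minus_commute: "l2_norm M (f - g) = l2_norm M (g - f)"
  by (simp add: l2_norm_def norm_minus_commute)

lemma l2_norm_eq_0_iff:
  assumes "f \<in> l2_space M"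
  shows "l2_norm M f = 0 \<longleftrightarrow> (AE x in M. f x = 0)"
  using integral_nonneg_eq_0_iff_AE[OF l2_spaceD(2)[OF assms]]
  by (simp add: l2_norm_def)

lemma borel_measurable_cnj [measurable (raw)]:
  assumes "f \<in> borel_measurable M"
  shows "(\<lambda>x. cnj (f x)) \<in> borel_measurable M"
  using measurable_compose[OF assms borel_measurable_continuous_onI[OF continuous_on_cnj[OF continuous_on_id]]] .

lemma integrable_l2_product:
  assumes "f \<in> l2_space M" "g \<in> l2_space M"
  shows "integrable M (\<lambda>x. f x * cnj (g x))"
proof (rule Bochner_Integration.integrable_bound)
  show "integrable M (\<lambda>x. (cmod (f x))\<^sup>2 + (cmod (g x))\<^sup>2)"
    using assms by (auto dest: l2_spaceD)
  have [measurable]: "f \<in> borel_measurable M" "g \<in> borel_measurable M"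
    using assms by (auto dest: l2_spaceD)
  show "(\<lambda>x. f x * cnj (g x)) \<in> borel_measurable M"
    by measurable
  show "AE x in M. norm (f x * cnj (g x)) \<le> norm ((cmod (f x))\<^sup>2 + (cmod (g x))\<^sup>2)"
  proof (intro AE_I2)
    fix x
    have "cmod (f x) * cmod (g x) \<le> (cmod (f x))\<^sup>2 + (cmod (g x))\<^sup>2"
      using sum_squares_bound[of "cmod (f x)" "cmod (g x)"]
        mult_nonneg_nonneg[OF norm_ge_zero[of "f x"] norm_ge_zero[of "g x"]] by linarith
    then show "norm (f x * cnj (g x)) \<le> norm ((cmod (f x))\<^sup>2 + (cmod (g x))\<^sup>2)"
      by (simp add: norm_mult)
  qed
qed

lemma l2_inner_add_left:
  assumes "f \<in> l2_space M" "g \<in> l2_space M" "h \<in> l2_space M"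
  shows "l2_inner M (f + g) h = l2_inner M f h + l2_inner M g h"
  using assms by (simp add: l2_inner_def distrib_right integrable_l2_product)

lemma l2_inner_scale_left: "l2_inner M (fun_scale c f) g = c * l2_inner M f g"
  by (simp add: l2_inner_def fun_scale_def mult.assoc)

lemma l2_inner_commute: "l2_inner M f g = cnj (l2_inner M g f)"
proof -
  have "(\<lambda>x. f x * cnj (g x)) = (\<lambda>x. cnj (g x * cnj (f x)))"
    by (simp add: fun_eq_iff mult.commute)
  then show ?thesis by (simp add: l2_inner_def del: complex_cnj_mult)
qed

lemma l2_inner_diff_left:
  assumes "f \<in> l2_space M" "g \<in> l2_space M" "h \<in> l2_space M"
  shows "l2_inner M (f - g) h = l2_inner M f h - l2_inner M g h"
  using assms by (simp add: l2_inner_def left_diff_distrib integrable_l2_product)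

lemma l2_inner_zero_left [simp]: "l2_inner M 0 g = 0"
  by (simp add: l2_inner_def)

lemma l2_inner_self: "l2_inner M f f = of_real ((l2_norm M f)\<^sup>2)"
  unfolding l2_norm_sq l2_inner_def
  by (simp add: complex_norm_square [symmetric] flip: of_real_power)

lemma l2_norm_add_sq:
  assumes "f \<in> l2_space M" "g \<in> l2_space M"
  shows "(l2_norm M (f + g))\<^sup>2 = (l2_norm M f)\<^sup>2 + (l2_norm M g)\<^sup>2 + 2 * Re (l2_inner M f g)"
proof -
  have sum: "f + g \<in> l2_space M" by (intro l2_space_add assms)
  have "l2_inner M (f + g) (f + g) = cnj (l2_inner M (f + g) f) + cnj (l2_inner M (f + g) g)"
    using assms sum
    by (metis complex_cnj_add l2_inner_add_left l2_inner_commute)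
  also have "\<dots> = l2_inner M f f + l2_inner M g g + (l2_inner M f g + cnj (l2_inner M f g))"
    using assms l2_inner_commute[of M g f] l2_inner_commute[of M f f] l2_inner_commute[of M g g]
    by (simp add: l2_inner_add_left flip: l2_inner_commute)
  finally have "Re (l2_inner M (f + g) (f + g)) =
      Re (l2_inner M f f + l2_inner M g g + (l2_inner M f g + cnj (l2_inner M f g)))"
    by simp
  then show ?thesis by (simp add: l2_inner_self)
qed

text \<open>
  The pointwise inequality \<open>2 \<bar>f\<bar> \<bar>g\<bar> \<le> r \<bar>f\<bar>\<^sup>2 + \<bar>g\<bar>\<^sup>2 / r\<close> with \<open>r = \<parallel>g\<parallel> / \<parallel>f\<parallel>\<close> is integrated; if
  one of the norms vanishes, so does the product almost everywhere.
\<close>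

lemma l2_Cauchy_Schwarz:
  assumes "f \<in> l2_space M" "g \<in> l2_space M"
  shows "cmod (l2_inner M f g) \<le> l2_norm M f * l2_norm M g"
proof (cases "l2_norm M f = 0 \<or> l2_norm M g = 0")
  case True
  then have "AE x in M. f x * cnj (g x) = 0"
    using assms by (auto simp: l2_norm_eq_0_iff elim: eventually_mono)
  then have "l2_inner M f g = 0"
    unfolding l2_inner_def by (rule integral_eq_zero_AE)
  then show ?thesis by simp
next
  case False
  define F G where "F = l2_norm M f" and "G = l2_norm M g"
  have pos: "F > 0" "G > 0"
    using False l2_norm_nonneg[of M f] l2_norm_nonneg[of M g] by (auto simp: F_def G_def less_le)
  define w where "w x = (G / F * (cmod (f x))\<^sup>2 + F / G * (cmod (g x))\<^sup>2) / 2" for x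
  have int: "integrable M w"
    unfolding w_def using assms by (simp add: l2_spaceD)
  have "cmod (l2_inner M f g) \<le> (\<integral>x. cmod (f x * cnj (g x)) \<partial>M)"
    unfolding l2_inner_def by (rule integral_norm_bound)
  also have "\<dots> \<le> (\<integral>x. w x \<partial>M)"
  proof (rule integral_mono)
    fix x
    have "0 \<le> (sqrt (G / F) * cmod (f x) - sqrt (F / G) * cmod (g x))\<^sup>2" by simp
    also have "\<dots> = G / F * (cmod (f x))\<^sup>2 + F / G * (cmod (g x))\<^sup>2
        - 2 * (sqrt (G / F) * sqrt (F / G)) * (cmod (f x) * cmod (g x))"
      using pos by (simp add: power2_diff power_mult_distrib algebra_simps)
    also have "sqrt (G / F) * sqrt (F / G) = 1"
      using pos by (simp flip: real_sqrt_mult)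
    finally show "norm (f x * cnj (g x)) \<le> w x"
      by (simp add: norm_mult w_def)
  qed (use int integrable_norm[OF integrable_l2_product[OF assms]] in auto)
  also have "(\<integral>x. w x \<partial>M) = (G / F * F\<^sup>2 + F / G * G\<^sup>2) / 2"
    unfolding w_def F_def G_def l2_norm_sq using assms
    by (simp add: l2_spaceD)
  also have "\<dots> = F * G" using pos by (simp add: power2_eq_square)
  finally show ?thesis by (simp add: F_def G_def)
qed

lemma l2_norm_triangle:
  assumes "f \<in> l2_space M" "g \<in> l2_space M"
  shows "l2_norm M (f + g) \<le> l2_norm M f + l2_norm M g"
proof (rule power2_le_imp_le)
  have "Re (l2_inner M f g) \<le> l2_norm M f * l2_norm M g"
    using l2_Cauchy_Schwarz[OF assms] complex_Re_le_cmod order_trans by blast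
  then show "(l2_norm M (f + g))\<^sup>2 \<le> (l2_norm M f + l2_norm M g)\<^sup>2"
    using l2_norm_add_sq[OF assms] by (simp add: power2_sum)
qed simp

lemma l2_dist_triangle:
  assumes "f \<in> l2_space M" "g \<in> l2_space M" "h \<in> l2_space M"
  shows "l2_norm M (f - h) \<le> l2_norm M (f - g) + l2_norm M (g - h)"
  using l2_norm_triangle[OF l2_space_diff[OF assms(1,2)] l2_space_diff[OF assms(2,3)]] by simp

section \<open>Completeness\<close>

text \<open>
  Riesz--Fischer. A subsequence \<open>v\<close> with \<open>\<parallel>v\<^sub>k\<^sub>+\<^sub>1 - v\<^sub>k\<parallel> < 4\<^sup>-\<^sup>k\<close> converges almost everywhere: the
  integral of \<open>\<Sum>\<^sub>k 4\<^sup>k \<bar>v\<^sub>k\<^sub>+\<^sub>1 - v\<^sub>k\<bar>\<^sup>2\<close> is finite, so that almost everywhere the increments are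
  eventually below \<open>2\<^sup>-\<^sup>k\<close>. By Fatou's lemma the pointwise limit is also the limit in norm.
\<close>

theorem l2_complete:
  fixes u :: "nat \<Rightarrow> 'a \<Rightarrow> complex"
  assumes u: "\<And>n. u n \<in> l2_space M"
    and cauchy: "\<And>e. e > 0 \<Longrightarrow> \<exists>N. \<forall>m\<ge>N. \<forall>n\<ge>N. l2_norm M (u m - u n) < e"
  obtains f where "f \<in> l2_space M" "(\<lambda>n. l2_norm M (f - u n)) \<longlonglongrightarrow> 0"
proof -
  have "\<exists>N. \<forall>m\<ge>N. \<forall>n\<ge>N. l2_norm M (u m - u n) < (1/4)^k" for k :: nat
    by (rule cauchy) simp
  then obtain N where N: "\<And>k m n. m \<ge> N k \<Longrightarrow> n \<ge> N k \<Longrightarrow> l2_norm M (u m - u n) < (1/4)^k"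
    by metis
  \<comment> \<open>The sum serves as a monotone bound for all \<open>N i\<close> with \<open>i \<le> k\<close>.\<close>
  define r where "r k = (\<Sum>i\<le>k. N i)" for k
  have r_ge: "N i \<le> r k" if "i \<le> k" for i k
    unfolding r_def using that by (intro member_le_sum) auto
  define v where "v k = u (r k)" for k
  define d where "d k = v (Suc k) - v k" for k
  have v: "v k \<in> l2_space M" for k by (simp add: v_def u)
  have d: "d k \<in> l2_space M" for k by (simp add: d_def v l2_space_diff)
  have d_small: "l2_norm M (d k) < (1/4)^k" for k
    unfolding d_def v_def by (rule N) (auto intro: r_ge)
  have [measurable]: "v k \<in> borel_measurable M" "u k \<in> borel_measurable M"
      "d k \<in> borel_measurable M" for k
    using u v d by (auto dest: l2_spaceD)
  have summand: "(\<integral>\<^sup>+x. ennreal (4^k * (cmod (d k x))\<^sup>2) \<partial>M) \<le> ennreal ((1/4)^k)" for k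
  proof -
    have "(\<integral>\<^sup>+x. ennreal (4^k * (cmod (d k x))\<^sup>2) \<partial>M) = ennreal (\<integral>x. 4^k * (cmod (d k x))\<^sup>2 \<partial>M)"
      by (rule nn_integral_eq_integral) (auto simp: l2_spaceD[OF d])
    also have "(\<integral>x. 4^k * (cmod (d k x))\<^sup>2 \<partial>M) = 4^k * (l2_norm M (d k))\<^sup>2"
      by (simp add: l2_norm_sq)
    also have "\<dots> \<le> 4^k * ((1/4)^k)\<^sup>2"
      using d_small[of k] by (intro mult_left_mono power_mono) auto
    also have "\<dots> = (1/4)^k"
      by (simp add: power2_eq_square power_divide)
    finally show ?thesis by (simp add: ennreal_leI)
  qed
  have "(\<integral>\<^sup>+x. (\<Sum>k. ennreal (4^k * (cmod (d k x))\<^sup>2)) \<partial>M)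
      = (\<Sum>k. \<integral>\<^sup>+x. ennreal (4^k * (cmod (d k x))\<^sup>2) \<partial>M)"
    by (rule nn_integral_suminf) measurable
  also have "\<dots> \<le> (\<Sum>k. ennreal ((1/4)^k))"
    by (intro suminf_le summand) auto
  also have "\<dots> < \<infinity>"
    by (subst suminf_ennreal2) (auto intro: summable_geometric)
  finally have "(\<integral>\<^sup>+x. (\<Sum>k. ennreal (4^k * (cmod (d k x))\<^sup>2)) \<partial>M) \<noteq> \<infinity>"
    by simp
  then have "AE x in M. (\<Sum>k. ennreal (4^k * (cmod (d k x))\<^sup>2)) \<noteq> \<infinity>"
    by (intro nn_integral_noteq_infinite) measurable
  then have conv: "AE x in M. convergent (\<lambda>k. v k x)"
  proof eventually_elim
    fix x assume "(\<Sum>k. ennreal (4^k * (cmod (d k x))\<^sup>2)) \<noteq> \<infinity>"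
    then have "summable (\<lambda>k. 4^k * (cmod (d k x))\<^sup>2)"
      by (intro summable_suminf_not_top) auto
    then have "(\<lambda>k. 4^k * (cmod (d k x))\<^sup>2) \<longlonglongrightarrow> 0"
      by (rule summable_LIMSEQ_zero)
    then have "eventually (\<lambda>k. 4^k * (cmod (d k x))\<^sup>2 < 1) sequentially"
      by (rule order_tendstoD) simp
    then have "eventually (\<lambda>k. norm (d k x) \<le> (1/2)^k) sequentially"
    proof eventually_elim
      fix k assume *: "4^k * (cmod (d k x))\<^sup>2 < 1"
      have "(2^k * cmod (d k x))\<^sup>2 = 4^k * (cmod (d k x))\<^sup>2"
        by (simp add: power2_eq_square mult_ac flip: power_mult_distrib)
      with * have "2^k * cmod (d k x) < 1"
        by (metis power2_less_imp_less one_power2 zero_le_one)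
      then show "norm (d k x) \<le> (1/2)^k"
        by (simp add: power_divide field_simps)
    qed
    then have "summable (\<lambda>k. d k x)"
      by (rule summable_comparison_test_ev) (auto intro: summable_geometric)
    then have "convergent (\<lambda>n. v 0 x + (\<Sum>k<n. d k x))"
      by (intro convergent_add convergent_const) (simp add: summable_iff_convergent)
    also have "(\<lambda>n. v 0 x + (\<Sum>k<n. d k x)) = (\<lambda>n. v n x)"
      by (simp add: d_def sum_lessThan_telescope[of "\<lambda>k. v k x"])
    finally show "convergent (\<lambda>k. v k x)" .
  qed
  define f where "f x = lim (\<lambda>k. v k x)" for x
  have f_meas [measurable]: "f \<in> borel_measurable M"
    unfolding f_def[abs_def] by (rule borel_measurable_lim_metric) measurable
  have key: "u n - f \<in> l2_space M \<and> l2_norm M (u n - f) \<le> (1/4)^K" if n: "n \<ge> N K" for n K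
  proof -
    have "(\<integral>\<^sup>+x. ennreal ((cmod (u n x - f x))\<^sup>2) \<partial>M)
        = (\<integral>\<^sup>+x. liminf (\<lambda>k. ennreal ((cmod (u n x - v k x))\<^sup>2)) \<partial>M)"
    proof (rule nn_integral_cong_AE, use conv in eventually_elim)
      fix x assume "convergent (\<lambda>k. v k x)"
      then have "(\<lambda>k. v k x) \<longlonglongrightarrow> f x"
        unfolding f_def by (simp add: convergent_LIMSEQ_iff)
      then have "(\<lambda>k. ennreal ((cmod (u n x - v k x))\<^sup>2)) \<longlonglongrightarrow> ennreal ((cmod (u n x - f x))\<^sup>2)"
        by (intro tendsto_intros)
      then show "ennreal ((cmod (u n x - f x))\<^sup>2) = liminf (\<lambda>k. ennreal ((cmod (u n x - v k x))\<^sup>2))"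
        by (rule lim_imp_Liminf[OF sequentially_bot, symmetric])
    qed
    also have "\<dots> \<le> liminf (\<lambda>k. \<integral>\<^sup>+x. ennreal ((cmod (u n x - v k x))\<^sup>2) \<partial>M)"
      by (rule nn_integral_liminf) measurable
    also have "\<dots> \<le> limsup (\<lambda>k. \<integral>\<^sup>+x. ennreal ((cmod (u n x - v k x))\<^sup>2) \<partial>M)"
      by (rule Liminf_le_Limsup) simp
    also have "\<dots> \<le> ennreal (((1/4)^K)\<^sup>2)"
    proof (rule Limsup_bounded)
      have "(\<integral>\<^sup>+x. ennreal ((cmod (u n x - v k x))\<^sup>2) \<partial>M) \<le> ennreal (((1/4)^K)\<^sup>2)"
        if "k \<ge> K" for k
      proof -
        have "(\<integral>\<^sup>+x. ennreal ((cmod ((u n - v k) x))\<^sup>2) \<partial>M) = ennreal ((l2_norm M (u n - v k))\<^sup>2)"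
          unfolding l2_norm_sq
          by (rule nn_integral_eq_integral) (use l2_spaceD(2)[OF l2_space_diff[OF u v]] in auto)
        also have "\<dots> \<le> ennreal (((1/4)^K)\<^sup>2)"
          using N[OF n, of "r k"] r_ge[OF that]
          by (intro ennreal_leI power_mono) (auto simp: v_def)
        finally show ?thesis by simp
      qed
      then show "\<forall>\<^sub>F k in sequentially.
          (\<integral>\<^sup>+x. ennreal ((cmod (u n x - v k x))\<^sup>2) \<partial>M) \<le> ennreal (((1/4)^K)\<^sup>2)"
        by (auto simp: eventually_sequentially)
    qed
    finally have le: "(\<integral>\<^sup>+x. ennreal ((cmod (u n x - f x))\<^sup>2) \<partial>M) \<le> ennreal (((1/4)^K)\<^sup>2)" .
    have int: "integrable M (\<lambda>x. (cmod (u n x - f x))\<^sup>2)"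
      by (rule integrableI_bounded) (use le in \<open>auto simp: top_unique less_top[symmetric]\<close>)
    have "ennreal (\<integral>x. (cmod (u n x - f x))\<^sup>2 \<partial>M) \<le> ennreal (((1/4)^K)\<^sup>2)"
      using le by (subst (asm) nn_integral_eq_integral[OF int]) auto
    then have "(l2_norm M (u n - f))\<^sup>2 \<le> ((1/4)^K)\<^sup>2"
      by (simp add: l2_norm_sq)
    then have "l2_norm M (u n - f) \<le> (1/4)^K"
      by (rule power2_le_imp_le) simp
    moreover have "u n - f \<in> l2_space M"
      using int by (simp add: l2_space_def fun_diff_def)
    ultimately show ?thesis by simp
  qed
  have "u (N 0) - (u (N 0) - f) \<in> l2_space M"
    by (rule l2_space_diff[OF u]) (use key[of 0 "N 0"] in simp)
  then have f: "f \<in> l2_space M" by simp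
  moreover have "(\<lambda>n. l2_norm M (f - u n)) \<longlonglongrightarrow> 0"
  proof (rule LIMSEQ_I)
    fix e :: real assume "e > 0"
    then obtain K where "(1/4)^K < e"
      using real_arch_pow_inv[of e "1/4"] by auto
    then have "\<forall>n\<ge>N K. norm (l2_norm M (f - u n) - 0) < e"
      using key[of K] by (force simp: l2_norm_minus_commute[of M f])
    then show "\<exists>N. \<forall>n\<ge>N. norm (l2_norm M (f - u n) - 0) < e" by blast
  qed
  ultimately show ?thesis by (rule that)
qed

section \<open>Closed subspaces\<close>

lemma l2_closure_iff:
  "f \<in> l2_closure M S \<longleftrightarrow>
    f \<in> l2_space M \<and> (\<forall>\<epsilon>>0. \<exists>g. g \<in> S \<and> g \<in> l2_space M \<and> l2_norm M (f - g) < \<epsilon>)"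
  by (auto simp: l2_closure_def fun_diff_def)

lemma subset_l2_closure: "S \<inter> l2_space M \<subseteq> l2_closure M S"
proof
  fix f assume "f \<in> S \<inter> l2_space M"
  then show "f \<in> l2_closure M S"
    unfolding l2_closure_iff by (auto intro!: exI[of _ f])
qed

lemma l2_closed_subspace_closure:
  assumes S: "cfun.subspace S"
  shows "l2_closed_subspace M (l2_closure M S)"
  unfolding l2_closed_subspace_def
proof (intro conjI)
  show sub: "l2_closure M S \<subseteq> l2_space M"
    by (auto simp: l2_closure_iff)
  show "cfun.subspace (l2_closure M S)"
  proof (rule cfun.subspaceI)
    have "0 \<in> S \<inter> l2_space M"
      using cfun.subspace_0[OF S] cfun.subspace_0[OF subspace_l2_space] by blast
    then show "0 \<in> l2_closure M S" using subset_l2_closure by blast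
  next
    fix f g assume f: "f \<in> l2_closure M S" and g: "g \<in> l2_closure M S"
    show "f + g \<in> l2_closure M S"
      unfolding l2_closure_iff
    proof (intro conjI allI impI)
      show "f + g \<in> l2_space M" using f g sub by (auto intro: l2_space_add)
      fix e :: real assume "e > 0"
      then have "e / 2 > 0" by simp
      then obtain f' g' where fg': "f' \<in> S" "f' \<in> l2_space M" "l2_norm M (f - f') < e / 2"
          "g' \<in> S" "g' \<in> l2_space M" "l2_norm M (g - g') < e / 2"
        using f g unfolding l2_closure_iff by metis
      have "l2_norm M (f + g - (f' + g')) = l2_norm M ((f - f') + (g - g'))"
        by (simp add: algebra_simps)
      also have "\<dots> \<le> l2_norm M (f - f') + l2_norm M (g - g')"
        using f g fg' sub by (intro l2_norm_triangle l2_space_diff) auto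
      also have "\<dots> < e" using fg' by simp
      finally show "\<exists>h. h \<in> S \<and> h \<in> l2_space M \<and> l2_norm M (f + g - h) < e"
        using fg' cfun.subspace_add[OF S] l2_space_add by (intro exI[of _ "f' + g'"]) auto
    qed
  next
    fix c f assume f: "f \<in> l2_closure M S"
    show "fun_scale c f \<in> l2_closure M S"
      unfolding l2_closure_iff
    proof (intro conjI allI impI)
      show "fun_scale c f \<in> l2_space M" using f sub by (auto intro: l2_space_scale)
      fix e :: real assume "e > 0"
      then have pos: "e / (cmod c + 1) > 0"
        by (simp add: add_nonneg_pos)
      then obtain f' where f': "f' \<in> S" "f' \<in> l2_space M" "l2_norm M (f - f') < e / (cmod c + 1)"
        using f unfolding l2_closure_iff by metis
      have "l2_norm M (fun_scale c f - fun_scale c f') = cmod c * l2_norm M (f - f')"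
        by (simp flip: l2_norm_scale cfun.scale_right_diff_distrib)
      also have "\<dots> \<le> (cmod c + 1) * l2_norm M (f - f')"
        by (intro mult_right_mono) auto
      also have "\<dots> < e"
        using f'(3) by (simp add: pos_less_divide_eq add_nonneg_pos mult.commute)
      finally show "\<exists>h. h \<in> S \<and> h \<in> l2_space M \<and> l2_norm M (fun_scale c f - h) < e"
        using f' cfun.subspace_scale[OF S] l2_space_scale by (intro exI[of _ "fun_scale c f'"]) auto
    qed
  qed
  show "l2_closure M (l2_closure M S) = l2_closure M S"
  proof
    show "l2_closure M S \<subseteq> l2_closure M (l2_closure M S)"
      using subset_l2_closure[of "l2_closure M S" M] sub by blast
    show "l2_closure M (l2_closure M S) \<subseteq> l2_closure M S"
    proof
      fix f assume f: "f \<in> l2_closure M (l2_closure M S)"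
      show "f \<in> l2_closure M S"
        unfolding l2_closure_iff
      proof (intro conjI allI impI)
        show f2: "f \<in> l2_space M" using f by (simp add: l2_closure_iff)
        fix e :: real assume "e > 0"
        then have "e / 2 > 0" by simp
        then obtain g where g: "g \<in> l2_closure M S" "g \<in> l2_space M" "l2_norm M (f - g) < e / 2"
          using f unfolding l2_closure_iff[of f] by metis
        then obtain h where h: "h \<in> S" "h \<in> l2_space M" "l2_norm M (g - h) < e / 2"
          using \<open>e / 2 > 0\<close> unfolding l2_closure_iff by metis
        have "l2_norm M (f - h) < e"
          using l2_dist_triangle[OF f2 g(2) h(2)] g h by simp
        then show "\<exists>h. h \<in> S \<and> h \<in> l2_space M \<and> l2_norm M (f - h) < e" using h by blast
      qed
    qed
  qed
qed

lemma l2_closed_subspaceD: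
  assumes "l2_closed_subspace M D"
  shows "cfun.subspace D" and "f \<in> D \<Longrightarrow> f \<in> l2_space M"
  using assms by (auto simp: l2_closed_subspace_def)

lemma l2_closed_approx:
  assumes "l2_closed_subspace M D" "f \<in> l2_space M"
    and "\<And>e. e > 0 \<Longrightarrow> \<exists>g\<in>D. l2_norm M (f - g) < e"
  shows "f \<in> D"
proof -
  have "f \<in> l2_closure M D"
    unfolding l2_closure_iff using assms l2_closed_subspaceD(2)[OF assms(1)] by blast
  then show ?thesis using assms(1) by (simp add: l2_closed_subspace_def)
qed

lemma l2_closed_limit:
  assumes "l2_closed_subspace M D" "f \<in> l2_space M" "\<And>n. u n \<in> D"
    and lim: "(\<lambda>n. l2_norm M (f - u n)) \<longlonglongrightarrow> 0"
  shows "f \<in> D"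
proof (rule l2_closed_approx[OF assms(1,2)])
  fix e :: real assume "e > 0"
  then have "eventually (\<lambda>n. l2_norm M (f - u n) < e) sequentially"
    by (rule order_tendstoD(2)[OF lim])
  then show "\<exists>g\<in>D. l2_norm M (f - g) < e"
    using assms(3) eventually_happens'[OF sequentially_bot] by blast
qed

lemma l2_closed_AE_cong:
  assumes D: "l2_closed_subspace M D" and f: "f \<in> D" and g: "g \<in> borel_measurable M"
    and eq: "AE x in M. f x = g x"
  shows "g \<in> D"
proof (rule l2_closed_approx[OF D])
  note f2 = l2_closed_subspaceD(2)[OF D f]
  show g2: "g \<in> l2_space M" by (rule l2_space_AE_cong[OF f2 g eq])
  have "l2_norm M (g - f) = 0"
    using l2_norm_eq_0_iff[OF l2_space_diff[OF g2 f2]] eq by (auto elim: eventually_mono)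
  then show "\<exists>h\<in>D. l2_norm M (g - h) < e" if "e > 0" for e
    using f that by (intro bexI[of _ f]) simp_all
qed

text \<open>
  Closed subspaces of \<open>L\<^sup>2\<close> are stable under dominated pointwise limits, by dominated convergence
  applied to \<open>\<bar>f - u\<^sub>n\<bar>\<^sup>2 \<le> 4 w\<^sup>2\<close>. The density arguments below rest on this.
\<close>

lemma l2_closed_dominated_limit:
  assumes D: "l2_closed_subspace M D" and u: "\<And>n. u n \<in> D"
    and f: "f \<in> borel_measurable M"
    and lim: "\<And>x. x \<in> space M \<Longrightarrow> (\<lambda>n. u n x) \<longlonglongrightarrow> f x"
    and bound: "\<And>n x. x \<in> space M \<Longrightarrow> cmod (u n x) \<le> w x"
    and w: "integrable M (\<lambda>x. (w x)\<^sup>2)"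
  shows "f \<in> D"
proof -
  have u2: "u n \<in> l2_space M" for n by (rule l2_closed_subspaceD(2)[OF D u])
  have fw: "cmod (f x) \<le> w x" if "x \<in> space M" for x
    by (rule LIMSEQ_le_const2[OF tendsto_norm[OF lim[OF that]]]) (use bound[OF that] in auto)
  have f2: "f \<in> l2_space M"
    by (rule l2_spaceI_bound[OF f w]) (auto intro!: power_mono fw)
  have "(\<lambda>n. \<integral>x. (cmod (f x - u n x))\<^sup>2 \<partial>M) \<longlonglongrightarrow> (\<integral>x. 0 \<partial>M)"
  proof (rule integral_dominated_convergence)
    show "integrable M (\<lambda>x. 4 * (w x)\<^sup>2)" using w by simp
    show "(\<lambda>x. (cmod (f x - u n x))\<^sup>2) \<in> borel_measurable M" for n
      using f l2_spaceD(1)[OF u2[of n]] by measurable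
    show "AE x in M. (\<lambda>n. (cmod (f x - u n x))\<^sup>2) \<longlonglongrightarrow> 0"
    proof (rule AE_I2)
      fix x assume "x \<in> space M"
      from tendsto_diff[OF tendsto_const[of "f x"] lim[OF this]]
      have "(\<lambda>n. (cmod (f x - u n x))\<^sup>2) \<longlonglongrightarrow> (cmod (f x - f x))\<^sup>2"
        by (intro tendsto_power tendsto_norm)
      then show "(\<lambda>n. (cmod (f x - u n x))\<^sup>2) \<longlonglongrightarrow> 0" by simp
    qed
    show "AE x in M. norm ((cmod (f x - u n x))\<^sup>2) \<le> 4 * (w x)\<^sup>2" for n
    proof (rule AE_I2)
      fix x assume x: "x \<in> space M"
      have "cmod (f x - u n x) \<le> 2 * w x"
        using norm_triangle_ineq4[of "f x" "u n x"] fw[OF x] bound[OF x, of n] by simp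
      then have "(cmod (f x - u n x))\<^sup>2 \<le> (2 * w x)\<^sup>2" by (intro power_mono) auto
      then show "norm ((cmod (f x - u n x))\<^sup>2) \<le> 4 * (w x)\<^sup>2"
        by (simp add: power_mult_distrib)
    qed
  qed simp
  then have "(\<lambda>n. sqrt (\<integral>x. (cmod (f x - u n x))\<^sup>2 \<partial>M)) \<longlonglongrightarrow> sqrt 0"
    by (intro tendsto_real_sqrt) simp
  then have "(\<lambda>n. l2_norm M (f - u n)) \<longlonglongrightarrow> 0"
    by (simp add: l2_norm_def)
  with D f2 u show ?thesis by (rule l2_closed_limit)
qed

text \<open>
  The sets whose indicator lies in \<open>D\<close> form a Dynkin system that contains the generator \<open>G\<close>, so they are all the measurable
  sets. Hence \<open>D\<close> contains the simple functions, and each function in \<open>L\<^sup>2\<close> is a pointwise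
  limit of simple functions that are dominated by twice its absolute value.
\<close>

theorem l2_closed_eq_space_if_indicators:
  fixes M :: "'a measure"
  assumes fin: "finite_measure M" and D: "l2_closed_subspace M D"
    and G: "Int_stable G" "G \<subseteq> Pow (space M)" "sets M = sigma_sets (space M) G"
    and ind: "\<And>X. X \<in> G \<Longrightarrow> (indicator X :: 'a \<Rightarrow> complex) \<in> D"
    and one: "(indicator (space M) :: 'a \<Rightarrow> complex) \<in> D"
  shows "D = l2_space M"
proof
  interpret finite_measure M by (rule fin)
  note sub = l2_closed_subspaceD(1)[OF D]
  show "D \<subseteq> l2_space M" using l2_closed_subspaceD(2)[OF D] by blast
  have ind_sets: "(indicator A :: 'a \<Rightarrow> complex) \<in> D" if "A \<in> sets M" for A
  proof -
    have "A \<in> sigma_sets (space M) G" using that G by simp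
    from G(1,2) this show ?thesis
    proof (induction rule: sigma_sets_induct_disjoint)
      case (basic A)
      then show ?case by (rule ind)
    next
      case empty
      then show ?case using cfun.subspace_0[OF sub] by (simp add: zero_fun_def)
    next
      case (compl A)
      have A: "A \<in> sets M" using compl(1) G by simp
      from cfun.subspace_diff[OF sub one compl(2)]
      show ?case
        by (rule l2_closed_AE_cong[OF D])
          (use A in \<open>auto intro!: borel_measurable_indicator AE_I2 simp: indicator_def\<close>)
    next
      case (union A)
      have A: "A i \<in> sets M" for i using union(2) G by auto
      define u :: "nat \<Rightarrow> 'a \<Rightarrow> complex" where "u n = (\<Sum>i<n. indicator (A i))" for n
      have u_eq: "u n = indicator (\<Union>i<n. A i)" for n
        unfolding u_def fun_eq_iff sum_fun_apply
        using disjoint_family_on_mono[OF subset_UNIV union(1)]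
        by (simp add: indicator_UN_disjoint)
      show ?case
      proof (rule l2_closed_dominated_limit[OF D, where w = "\<lambda>_. 1"])
        show "u n \<in> D" for n
          unfolding u_def using union(3) by (intro cfun.subspace_sum[OF sub]) auto
        show "(\<lambda>n. u n x) \<longlonglongrightarrow> indicator (\<Union>i. A i) x" for x
          unfolding u_eq by (rule LIMSEQ_indicator_UN)
        show "cmod (u n x) \<le> 1" for n x
          unfolding u_eq by (simp add: indicator_def)
      qed (use A in auto)
    qed
  qed
  show "l2_space M \<subseteq> D"
  proof
    fix f assume f: "f \<in> l2_space M"
    from borel_measurable_implies_sequence_metric[OF l2_spaceD(1)[OF f], of 0]
    obtain F where F: "\<And>i. simple_function M (F i)"
        "\<And>x. x \<in> space M \<Longrightarrow> (\<lambda>i. F i x) \<longlonglongrightarrow> f x"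
        "\<And>i x. x \<in> space M \<Longrightarrow> cmod (F i x) \<le> 2 * cmod (f x)"
      by simp metis
    show "f \<in> D"
    proof (rule l2_closed_dominated_limit[OF D, where u = F])
      show "F i \<in> D" for i
      proof -
        have "(\<Sum>y\<in>F i ` space M. fun_scale y (indicator (F i -` {y} \<inter> space M))) \<in> D"
          by (intro cfun.subspace_sum[OF sub] cfun.subspace_scale[OF sub] ind_sets
              simple_functionD(2)[OF F(1)])
        then show ?thesis
        proof (rule l2_closed_AE_cong[OF D])
          show "F i \<in> borel_measurable M" by (rule borel_measurable_simple_function[OF F(1)])
          show "AE x in M. (\<Sum>y\<in>F i ` space M. fun_scale y (indicator (F i -` {y} \<inter> space M))) x = F i x"
          proof (rule AE_I2)
            fix x assume x: "x \<in> space M"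
            have fin: "finite (F i ` space M)" by (rule simple_functionD(1)[OF F(1)])
            have "(\<Sum>y\<in>F i ` space M. fun_scale y (indicator (F i -` {y} \<inter> space M))) x
                = (\<Sum>y\<in>F i ` space M. fun_scale y (indicator (F i -` {y} \<inter> space M)) x)"
              using fin by (induction rule: finite_induct) auto
            also have "\<dots> = (\<Sum>y\<in>F i ` space M. if y = F i x then y else 0)"
              using x by (intro sum.cong) (auto simp: fun_scale_def indicator_def)
            also have "\<dots> = F i x" using x fin by simp
            finally show "(\<Sum>y\<in>F i ` space M. fun_scale y (indicator (F i -` {y} \<inter> space M))) x = F i x" .
          qed
        qed
      qed
    qed (use F f in \<open>auto simp: l2_spaceD power_mult_distrib\<close>)
  qed
qed

section \<open>Orthogonal families of closed subspaces\<close>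

text \<open>
  By the Cauchy--Schwarz inequality the inner product with \<open>g\<close> is continuous.
\<close>

lemma l2_orthogonal_closure_left:
  assumes orth: "\<And>f. f \<in> S \<inter> l2_space M \<Longrightarrow> l2_inner M f g = 0"
    and g: "g \<in> l2_space M" and f: "f \<in> l2_closure M S"
  shows "l2_inner M f g = 0"
proof -
  have f2: "f \<in> l2_space M" using f by (simp add: l2_closure_iff)
  have "cmod (l2_inner M f g) \<le> e" if "e > 0" for e
  proof -
    have "e / (l2_norm M g + 1) > 0" using that by (simp add: add_nonneg_pos)
    then obtain h where h: "h \<in> S" "h \<in> l2_space M" "l2_norm M (f - h) < e / (l2_norm M g + 1)"
      using f unfolding l2_closure_iff by metis
    have "l2_inner M f g = l2_inner M (f - h) g"
      using orth[of h] h f2 g by (simp add: l2_inner_diff_left)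
    also have "cmod \<dots> \<le> l2_norm M (f - h) * l2_norm M g"
      by (intro l2_Cauchy_Schwarz l2_space_diff f2 h g)
    also have "\<dots> \<le> e / (l2_norm M g + 1) * (l2_norm M g + 1)"
      using h that by (intro mult_mono) (auto simp: add_nonneg_pos less_imp_le)
    also have "\<dots> = e" by (simp add: add_nonneg_eq_0_iff)
    finally show ?thesis .
  qed
  then show ?thesis
    by (metis dense_ge norm_le_zero_iff)
qed

lemma l2_orthogonal_closures:
  assumes orth: "\<And>f g. f \<in> S \<inter> l2_space M \<Longrightarrow> g \<in> T \<inter> l2_space M \<Longrightarrow> l2_inner M f g = 0"
    and f: "f \<in> l2_closure M S" and g: "g \<in> l2_closure M T"
  shows "l2_inner M f g = 0"
proof (rule l2_orthogonal_closure_left[OF _ _ f])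
  show "g \<in> l2_space M" using g by (simp add: l2_closure_iff)
  fix f' assume f': "f' \<in> S \<inter> l2_space M"
  have "l2_inner M g f' = 0"
    by (rule l2_orthogonal_closure_left[OF _ _ g]) 
      (use f' in \<open>auto simp: l2_inner_commute[of M _ f'] orth\<close>)
  then show "l2_inner M f' g = 0" by (simp add: l2_inner_commute[of M f'])
qed

lemma l2_norm_add_sq_orthogonal:
  assumes "f \<in> l2_space M" "g \<in> l2_space M" "l2_inner M f g = 0"
  shows "(l2_norm M (f + g))\<^sup>2 = (l2_norm M f)\<^sup>2 + (l2_norm M g)\<^sup>2"
  using l2_norm_add_sq[OF assms(1,2)] assms(3) by simp

lemma l2_inner_sum_left:
  assumes "\<And>i. i \<in> F \<Longrightarrow> f i \<in> l2_space M" "g \<in> l2_space M"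
  shows "l2_inner M (\<Sum>i\<in>F. f i) g = (\<Sum>i\<in>F. l2_inner M (f i) g)"
  using assms(1)
proof (induction F rule: infinite_finite_induct)
  case (insert i F)
  have "(\<Sum>i\<in>F. f i) \<in> l2_space M"
    using insert by (intro cfun.subspace_sum[OF subspace_l2_space]) auto
  then show ?case
    unfolding sum.insert[OF insert(1,2)]
    using insert assms(2) by (subst l2_inner_add_left) auto
qed auto

lemma l2_has_sum_iff:
  "l2_has_sum M g I f \<longleftrightarrow>
    ((\<lambda>F. l2_norm M (f - (\<Sum>i\<in>F. g i))) \<longlongrightarrow> 0) (finite_subsets_at_top I)"
proof -
  have "(\<lambda>x. f x - (\<Sum>i\<in>F. g i x)) = f - (\<Sum>i\<in>F. g i)" for F
    by (simp add: fun_eq_iff sum_fun_apply)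
  then show ?thesis by (simp add: l2_has_sum_def)
qed

lemma l2_orthogonal_closed_spans:
  assumes S: "S \<subseteq> l2_space M" and T: "T \<subseteq> l2_space M"
    and orth: "\<And>f g. f \<in> S \<Longrightarrow> g \<in> T \<Longrightarrow> l2_inner M f g = 0"
    and f: "f \<in> l2_closure M (cfun.span S)" and g: "g \<in> l2_closure M (cfun.span T)"
  shows "l2_inner M f g = 0"
proof -
  have left: "h \<in> l2_space M \<and> l2_inner M h k = 0"
    if h: "h \<in> cfun.span A" and A: "A \<subseteq> l2_space M" and k: "k \<in> l2_space M"
      and 0: "\<And>a. a \<in> A \<Longrightarrow> l2_inner M a k = 0" for h k A
    using h
  proof (induction rule: cfun.span_induct)
    case base
    show ?case
      by (rule cfun.subspaceI)
        (auto simp: cfun.subspace_0[OF subspace_l2_space] l2_space_add l2_space_scale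
          l2_inner_add_left[OF _ _ k] l2_inner_scale_left)
  qed (use A 0 in auto)
  show ?thesis
  proof (rule l2_orthogonal_closures[OF _ f g])
    fix f g assume f: "f \<in> cfun.span S \<inter> l2_space M" and g: "g \<in> cfun.span T \<inter> l2_space M"
    have "l2_inner M a g = 0" if a: "a \<in> S" for a
    proof -
      have "l2_inner M b a = 0" if "b \<in> T" for b
        using orth[OF a that] by (simp add: l2_inner_commute[of M b])
      then have "l2_inner M g a = 0" using left[of g T a] g T S a by blast
      then show ?thesis by (simp add: l2_inner_commute[of M a])
    qed
    then show "l2_inner M f g = 0" using left[of f S g] f g S by blast
  qed
qed

locale l2_orthogonal_family =
  fixes M :: "'a measure" and I :: "'i set" and A :: "'i \<Rightarrow> ('a \<Rightarrow> complex) set"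
  assumes closed: "i \<in> I \<Longrightarrow> l2_closed_subspace M (A i)"
    and orth: "i \<in> I \<Longrightarrow> j \<in> I \<Longrightarrow> i \<noteq> j \<Longrightarrow> f \<in> A i \<Longrightarrow> g \<in> A j \<Longrightarrow> l2_inner M f g = 0"
begin

lemma mem_l2: "i \<in> I \<Longrightarrow> f \<in> A i \<Longrightarrow> f \<in> l2_space M"
  using closed l2_closed_subspaceD(2) by blast

lemma sum_l2:
  assumes "F \<subseteq> I" "\<And>i. i \<in> F \<Longrightarrow> g i \<in> A i"
  shows "(\<Sum>i\<in>F. g i) \<in> l2_space M"
  using assms mem_l2 by (intro cfun.subspace_sum[OF subspace_l2_space]) blast

lemma inner_sum_component:
  assumes "finite F" "F \<subseteq> I" "\<And>i. i \<in> F \<Longrightarrow> g i \<in> A i" "i \<in> F" "a \<in> A i"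
  shows "l2_inner M (\<Sum>j\<in>F. g j) a = l2_inner M (g i) a"
proof -
  have "l2_inner M (\<Sum>j\<in>F. g j) a = (\<Sum>j\<in>F. l2_inner M (g j) a)"
    using assms mem_l2 by (intro l2_inner_sum_left) blast+
  also have "\<dots> = (\<Sum>j\<in>F. if j = i then l2_inner M (g i) a else 0)"
  proof (rule sum.cong)
    fix j assume "j \<in> F"
    then show "l2_inner M (g j) a = (if j = i then l2_inner M (g i) a else 0)"
      using assms orth[of j i "g j" a] by auto
  qed simp
  also have "\<dots> = l2_inner M (g i) a" using assms by simp
  finally show ?thesis .
qed

lemma inner_sum_other:
  assumes "F \<subseteq> I" "\<And>i. i \<in> F \<Longrightarrow> g i \<in> A i" "i \<in> I" "i \<notin> F" "a \<in> A i"
  shows "l2_inner M (\<Sum>j\<in>F. g j) a = 0"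
proof -
  have "l2_inner M (\<Sum>j\<in>F. g j) a = (\<Sum>j\<in>F. l2_inner M (g j) a)"
    using assms mem_l2 by (intro l2_inner_sum_left) blast+
  also have "\<dots> = 0"
    using assms orth by (intro sum.neutral) blast
  finally show ?thesis .
qed

lemma inner_sum_zero:
  assumes "F \<subseteq> I" "\<And>i. i \<in> F \<Longrightarrow> g i \<in> A i" "f \<in> l2_space M"
    and "\<And>i. i \<in> F \<Longrightarrow> l2_inner M f (g i) = 0"
  shows "l2_inner M f (\<Sum>j\<in>F. g j) = 0"
proof -
  have "l2_inner M (\<Sum>j\<in>F. g j) f = (\<Sum>j\<in>F. l2_inner M (g j) f)"
    using assms mem_l2 by (intro l2_inner_sum_left) blast+
  also have "\<dots> = 0"
    using assms(4) l2_inner_commute[of M f] by (intro sum.neutral) (metis complex_cnj_zero_iff)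
  finally show ?thesis by (simp add: l2_inner_commute[of M f])
qed

lemma norm_sum_sq:
  assumes "finite F" "F \<subseteq> I" "\<And>i. i \<in> F \<Longrightarrow> g i \<in> A i"
  shows "(l2_norm M (\<Sum>i\<in>F. g i))\<^sup>2 = (\<Sum>i\<in>F. (l2_norm M (g i))\<^sup>2)"
  using assms
proof (induction F rule: finite_induct)
  case (insert i F)
  have "l2_inner M (\<Sum>j\<in>F. g j) (g i) = 0"
    using insert by (intro inner_sum_other) auto
  then have "l2_inner M (g i) (\<Sum>j\<in>F. g j) = 0"
    by (simp add: l2_inner_commute[of M "g i"])
  then have "(l2_norm M (g i + (\<Sum>j\<in>F. g j)))\<^sup>2 = (l2_norm M (g i))\<^sup>2 + (l2_norm M (\<Sum>j\<in>F. g j))\<^sup>2"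
    using insert mem_l2 by (intro l2_norm_add_sq_orthogonal sum_l2) auto
  moreover have "(l2_norm M (\<Sum>j\<in>F. g j))\<^sup>2 = (\<Sum>j\<in>F. (l2_norm M (g j))\<^sup>2)"
    using insert by auto
  ultimately show ?case
    by (simp only: sum.insert[OF insert(1,2)])
qed simp

text \<open>
  The components of a convergent orthogonal sum are determined by the sum: its inner product with
  an element of one summand sees only the component in that summand.
\<close>

lemma has_sum_inner:
  assumes sum: "l2_has_sum M g I f" and f: "f \<in> l2_space M"
    and g: "\<And>i. i \<in> I \<Longrightarrow> g i \<in> A i" and i: "i \<in> I" and a: "a \<in> A i"
  shows "l2_inner M f a = l2_inner M (g i) a"
proof -
  have a2: "a \<in> l2_space M" using i a mem_l2 by blast
  have "cmod (l2_inner M f a - l2_inner M (g i) a) \<le> 0"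
  proof (rule tendsto_lowerbound)
    show "((\<lambda>F. l2_norm M (f - (\<Sum>i\<in>F. g i)) * l2_norm M a) \<longlongrightarrow> 0) (finite_subsets_at_top I)"
      using sum unfolding l2_has_sum_iff by (rule tendsto_mult_left_zero)
    show "\<forall>\<^sub>F F in finite_subsets_at_top I.
        cmod (l2_inner M f a - l2_inner M (g i) a) \<le> l2_norm M (f - (\<Sum>i\<in>F. g i)) * l2_norm M a"
      unfolding eventually_finite_subsets_at_top
    proof (intro exI[of _ "{i}"] conjI allI impI)
      fix F assume F: "finite F \<and> {i} \<subseteq> F \<and> F \<subseteq> I"
      have s2: "(\<Sum>i\<in>F. g i) \<in> l2_space M" using F g by (intro sum_l2) auto
      have "l2_inner M (\<Sum>i\<in>F. g i) a = l2_inner M (g i) a"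
        using F g i a by (intro inner_sum_component) auto
      then have "l2_inner M f a - l2_inner M (g i) a = l2_inner M (f - (\<Sum>i\<in>F. g i)) a"
        using l2_inner_diff_left[OF f s2 a2] by simp
      also have "cmod \<dots> \<le> l2_norm M (f - (\<Sum>i\<in>F. g i)) * l2_norm M a"
        by (intro l2_Cauchy_Schwarz l2_space_diff f s2 a2)
      finally show "cmod (l2_inner M f a - l2_inner M (g i) a)
          \<le> l2_norm M (f - (\<Sum>i\<in>F. g i)) * l2_norm M a" .
    qed (use i in auto)
  qed (rule finite_subsets_at_top_neq_bot)
  then show ?thesis by simp
qed

lemma has_sum_unique:
  assumes f: "f \<in> l2_space M"
    and g: "l2_has_sum M g I f" "\<And>i. i \<in> I \<Longrightarrow> g i \<in> A i"
    and h: "l2_has_sum M h I f" "\<And>i. i \<in> I \<Longrightarrow> h i \<in> A i"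
    and i: "i \<in> I"
  shows "AE x in M. h i x = g i x"
proof -
  define a where "a = h i - g i"
  have a: "a \<in> A i"
    unfolding a_def using l2_closed_subspaceD(1)[OF closed[OF i]] g h i
    by (intro cfun.subspace_diff) auto
  have "l2_inner M a a = l2_inner M (h i) a - l2_inner M (g i) a"
    unfolding a_def using mem_l2[OF i] g h i a
    by (intro l2_inner_diff_left) (auto simp: a_def)
  also have "\<dots> = 0"
    using has_sum_inner[OF g(1) f g(2) i a] has_sum_inner[OF h(1) f h(2) i a] by simp
  finally have "l2_norm M a = 0" by (simp add: l2_inner_self)
  then show ?thesis
    using l2_norm_eq_0_iff[OF mem_l2[OF i a]] by (auto simp: a_def elim: eventually_mono)
qed

text \<open>
  Sums over finite index sets that contain \<open>F n\<close> differ from the one over \<open>F n\<close> by at most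
  \<open>2\<^sup>-\<^sup>n\<close>, by Pythagoras, if \<open>F n\<close> is chosen such that the squared norms outside \<open>F n\<close> sum up to less
  than \<open>4\<^sup>-\<^sup>n\<close>. So the sums over \<open>F n\<close> form a Cauchy sequence, and its limit is the limit of the
  net of all finite sums.
\<close>

lemma summable_imp_has_sum:
  assumes g: "\<And>i. i \<in> I \<Longrightarrow> g i \<in> A i"
    and summable: "(\<lambda>i. (l2_norm M (g i))\<^sup>2) summable_on I"
  shows "\<exists>f\<in>l2_space M. l2_has_sum M g I f"
proof -
  define S where "S = (\<Sum>\<^sub>\<infinity>i\<in>I. (l2_norm M (g i))\<^sup>2)"
  define N where "N F = (\<Sum>i\<in>F. (l2_norm M (g i))\<^sup>2)" for F
  have lim: "(N \<longlongrightarrow> S) (finite_subsets_at_top I)"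
    using has_sum_infsum[OF summable] by (simp add: has_sum_def N_def[abs_def] S_def)
  have le_S: "N F \<le> S" if "finite F" "F \<subseteq> I" for F
    unfolding N_def S_def using that summable by (intro finite_sum_le_infsum) auto
  have "\<exists>F. finite F \<and> F \<subseteq> I \<and> N F > S - ((1/2)^n)\<^sup>2" for n :: nat
  proof -
    have "S - ((1/2)^n)\<^sup>2 < S" by simp
    then have "eventually (\<lambda>F. N F > S - ((1/2)^n)\<^sup>2) (finite_subsets_at_top I)"
      by (rule order_tendstoD(1)[OF lim])
    then show ?thesis
      unfolding eventually_finite_subsets_at_top by blast
  qed
  then obtain F0 where F0: "\<And>n. finite (F0 n)" "\<And>n. F0 n \<subseteq> I" "\<And>n. N (F0 n) > S - ((1/2)^n)\<^sup>2"
    by metis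
  define F where "F n = (\<Union>k\<le>n. F0 k)" for n
  have F: "finite (F n)" "F n \<subseteq> I" "F0 n \<subseteq> F n" for n
    using F0 by (auto simp: F_def)
  have F_mono: "F m \<subseteq> F n" if "m \<le> n" for m n
    using that by (force simp: F_def)
  have tail: "l2_norm M ((\<Sum>i\<in>G. g i) - (\<Sum>i\<in>F n. g i)) < (1/2)^n"
    if G: "finite G" "F n \<subseteq> G" "G \<subseteq> I" for G n
  proof -
    have "(l2_norm M ((\<Sum>i\<in>G. g i) - (\<Sum>i\<in>F n. g i)))\<^sup>2
        = (l2_norm M (\<Sum>i\<in>G - F n. g i))\<^sup>2"
      by (simp only: sum_diff[OF G(1,2)])
    also have "\<dots> = (\<Sum>i\<in>G - F n. (l2_norm M (g i))\<^sup>2)"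
      using G g by (intro norm_sum_sq) auto
    also have "\<dots> = N G - N (F n)"
      unfolding N_def using G by (intro sum_diff)
    also have "\<dots> < ((1/2)^n)\<^sup>2"
    proof -
      have "N (F0 n) \<le> N (F n)"
        unfolding N_def using F by (intro sum_mono2) auto
      then show ?thesis using le_S[of G] G F0(3)[of n] by simp
    qed
    finally show ?thesis by (rule power2_less_imp_less) simp
  qed
  define u where "u n = (\<Sum>i\<in>F n. g i)" for n
  have u: "u n \<in> l2_space M" for n
    unfolding u_def using F g by (intro sum_l2) blast+
  obtain f where f: "f \<in> l2_space M" and f_lim: "(\<lambda>n. l2_norm M (f - u n)) \<longlonglongrightarrow> 0"
  proof (rule l2_complete[of u M, OF u])
    fix e :: real assume "e > 0"
    then have "e / 2 > 0" by simp
    then obtain K where K: "(1/2)^K < e / 2"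
      using real_arch_pow_inv[of "e/2" "1/2"] by auto
    have "l2_norm M (u m - u n) < e" if "m \<ge> K" "n \<ge> K" for m n
    proof -
      have "l2_norm M (u m - u n) \<le> l2_norm M (u m - u K) + l2_norm M (u K - u n)"
        by (intro l2_dist_triangle u)
      also have "l2_norm M (u K - u n) = l2_norm M (u n - u K)"
        by (rule l2_norm_minus_commute)
      also have "l2_norm M (u m - u K) + l2_norm M (u n - u K) < (1/2)^K + (1/2)^K"
        unfolding u_def using that F F_mono by (intro add_strict_mono tail) auto
      finally show ?thesis using K by linarith
    qed
    then show "\<exists>N. \<forall>m\<ge>N. \<forall>n\<ge>N. l2_norm M (u m - u n) < e" by blast
  qed
  have "l2_has_sum M g I f"
    unfolding l2_has_sum_iff
  proof (rule tendstoI)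
    fix e :: real assume "e > 0"
    then have e2: "e / 2 > 0" by simp
    have "eventually (\<lambda>n. l2_norm M (f - u n) < e / 2 \<and> (1/2)^n < e / 2) sequentially"
      by (intro eventually_conj order_tendstoD(2)[OF f_lim e2]
          order_tendstoD(2)[OF LIMSEQ_power_zero e2]) simp
    then obtain n where n: "l2_norm M (f - u n) < e / 2" "(1/2)^n < e / 2"
      using eventually_happens'[OF sequentially_bot] by blast
    show "\<forall>\<^sub>F G in finite_subsets_at_top I. dist (l2_norm M (f - (\<Sum>i\<in>G. g i))) 0 < e"
      unfolding eventually_finite_subsets_at_top
    proof (intro exI[of _ "F n"] conjI allI impI)
      fix G assume G: "finite G \<and> F n \<subseteq> G \<and> G \<subseteq> I"
      have G2: "(\<Sum>i\<in>G. g i) \<in> l2_space M" using G g by (intro sum_l2) auto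
      have "l2_norm M (f - (\<Sum>i\<in>G. g i))
          \<le> l2_norm M (f - u n) + l2_norm M (u n - (\<Sum>i\<in>G. g i))"
        by (intro l2_dist_triangle f u G2)
      also have "l2_norm M (u n - (\<Sum>i\<in>G. g i)) = l2_norm M ((\<Sum>i\<in>G. g i) - u n)"
        by (rule l2_norm_minus_commute)
      also have "\<dots> < (1/2)^n"
        unfolding u_def using G by (intro tail) auto
      finally have "l2_norm M (f - (\<Sum>i\<in>G. g i)) < e"
        using n by linarith
      then show "dist (l2_norm M (f - (\<Sum>i\<in>G. g i))) 0 < e" by simp
    qed (use F in auto)
  qed
  with f show ?thesis by blast
qed

text \<open>
  Pythagoras: if the \<open>g i\<close> are the orthogonal projections of \<open>f\<close>, then \<open>f - \<Sum>\<^sub>i g i\<close> is orthogonal to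
  all \<open>g i - h i\<close>. With \<open>h = 0\<close> this is Bessel's equality.
\<close>

lemma best_approximation:
  assumes F: "finite F" "F \<subseteq> I" and f: "f \<in> l2_space M"
    and g: "\<And>i. i \<in> F \<Longrightarrow> g i \<in> A i"
    and proj: "\<And>i a. i \<in> F \<Longrightarrow> a \<in> A i \<Longrightarrow> l2_inner M (f - g i) a = 0"
    and h: "\<And>i. i \<in> F \<Longrightarrow> h i \<in> A i"
  shows "(l2_norm M (f - (\<Sum>i\<in>F. h i)))\<^sup>2 =
    (l2_norm M (f - (\<Sum>i\<in>F. g i)))\<^sup>2 + (\<Sum>i\<in>F. (l2_norm M (g i - h i))\<^sup>2)"
proof -
  have g2: "(\<Sum>i\<in>F. g i) \<in> l2_space M" using F g by (intro sum_l2)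
  have d: "g i - h i \<in> A i" if "i \<in> F" for i
    using that F g h l2_closed_subspaceD(1)[OF closed] by (intro cfun.subspace_diff) auto
  have "l2_inner M (f - (\<Sum>i\<in>F. g i)) (g i - h i) = 0" if i: "i \<in> F" for i
  proof -
    have iI: "i \<in> I" using i F by blast
    have "l2_inner M (f - (\<Sum>i\<in>F. g i)) (g i - h i)
        = l2_inner M f (g i - h i) - l2_inner M (g i) (g i - h i)"
      using inner_sum_component[OF F g i d[OF i]] mem_l2[OF iI d[OF i]]
      by (simp add: l2_inner_diff_left f g2)
    also have "\<dots> = l2_inner M (f - g i) (g i - h i)"
      using mem_l2[OF iI d[OF i]] mem_l2[OF iI g[OF i]] by (simp add: l2_inner_diff_left f)
    also have "\<dots> = 0" using proj[OF i d[OF i]] .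
    finally show ?thesis .
  qed
  then have "l2_inner M (f - (\<Sum>i\<in>F. g i)) (\<Sum>i\<in>F. g i - h i) = 0"
    using F d by (intro inner_sum_zero l2_space_diff f g2)
  then have "(l2_norm M ((f - (\<Sum>i\<in>F. g i)) + (\<Sum>i\<in>F. g i - h i)))\<^sup>2
      = (l2_norm M (f - (\<Sum>i\<in>F. g i)))\<^sup>2 + (l2_norm M (\<Sum>i\<in>F. g i - h i))\<^sup>2"
    using F d by (intro l2_norm_add_sq_orthogonal l2_space_diff f g2 sum_l2)
  moreover have "(f - (\<Sum>i\<in>F. g i)) + (\<Sum>i\<in>F. g i - h i) = f - (\<Sum>i\<in>F. h i)"
    by (simp add: sum_subtractf)
  ultimately show ?thesis using norm_sum_sq[OF F(1,2) d] by simp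
qed

text \<open>
  Let \<open>u\<^sub>n\<close> be finite sums of elements of the summands that converge to \<open>f\<close>. By orthogonality
  \<open>\<parallel>v\<^sub>m - v\<^sub>n\<parallel> \<le> \<parallel>u\<^sub>m - u\<^sub>n\<parallel>\<close> holds for the components \<open>v\<^sub>n\<close> of \<open>u\<^sub>n\<close> in the \<open>i\<close>-th summand. So these
  converge, and their limit is the projection of \<open>f\<close> to this summand.
\<close>

lemma projection_exists:
  assumes dense: "\<And>f e. f \<in> l2_space M \<Longrightarrow> e > 0 \<Longrightarrow> \<exists>F h. finite F \<and> F \<subseteq> I \<and>
      (\<forall>i\<in>F. h i \<in> A i) \<and> l2_norm M (f - (\<Sum>i\<in>F. h i)) < e"
    and f: "f \<in> l2_space M" and i: "i \<in> I"
  shows "\<exists>g\<in>A i. \<forall>a\<in>A i. l2_inner M (f - g) a = 0"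
proof -
  note sub = l2_closed_subspaceD(1)[OF closed[OF i]]
  have "\<exists>F h. finite F \<and> F \<subseteq> I \<and>
      (\<forall>i\<in>F. h i \<in> A i) \<and> l2_norm M (f - (\<Sum>i\<in>F. h i)) < inverse (real (Suc n))" for n
    by (rule dense[OF f]) simp
  then obtain F h where Fh: "\<And>n. finite (F n)" "\<And>n. F n \<subseteq> I" "\<And>n i. i \<in> F n \<Longrightarrow> h n i \<in> A i"
      "\<And>n. l2_norm M (f - (\<Sum>i\<in>F n. h n i)) < inverse (real (Suc n))"
    by metis
  define u where "u n = (\<Sum>i\<in>F n. h n i)" for n
  \<comment> \<open>The component of \<open>u n\<close> in the \<open>i\<close>-th summand.\<close>
  define v where "v n = (if i \<in> F n then h n i else 0)" for n
  have u: "u n \<in> l2_space M" for n unfolding u_def using Fh by (intro sum_l2) auto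
  have v: "v n \<in> A i" for n using Fh(3) cfun.subspace_0[OF sub] by (simp add: v_def)
  have v2: "v n \<in> l2_space M" for n using mem_l2[OF i v] .
  have inner_v: "l2_inner M (u n) a = l2_inner M (v n) a" if a: "a \<in> A i" for n a
    using inner_sum_component[OF Fh(1,2,3) _ a, of n] inner_sum_other[OF Fh(2,3) i _ a, of n]
    by (auto simp: u_def v_def)
  have u_lim: "(\<lambda>n. l2_norm M (f - u n)) \<longlonglongrightarrow> 0"
    by (rule tendsto_sandwich[OF _ _ tendsto_const LIMSEQ_inverse_real_of_nat])
      (use Fh(4) in \<open>auto simp: u_def less_imp_le simp del: of_nat_Suc\<close>)
  have v_u: "l2_norm M (v m - v n) \<le> l2_norm M (u m - u n)" for m n
  proof -
    have a: "v m - v n \<in> A i" using cfun.subspace_diff[OF sub v v] .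
    note a2 = mem_l2[OF i a]
    have "l2_inner M (v m - v n) (v m - v n) = l2_inner M (u m - u n) (v m - v n)"
      using l2_inner_diff_left[OF v2 v2 a2] l2_inner_diff_left[OF u u a2] inner_v[OF a] by simp
    then have "(l2_norm M (v m - v n))\<^sup>2 = cmod (l2_inner M (u m - u n) (v m - v n))"
      by (metis l2_inner_self norm_of_real abs_of_nonneg zero_le_power2)
    also have "\<dots> \<le> l2_norm M (u m - u n) * l2_norm M (v m - v n)"
      by (intro l2_Cauchy_Schwarz l2_space_diff u v2)
    finally have *: "l2_norm M (v m - v n) * l2_norm M (v m - v n)
        \<le> l2_norm M (u m - u n) * l2_norm M (v m - v n)"
      by (simp add: power2_eq_square)
    show ?thesis
    proof (cases "l2_norm M (v m - v n) = 0")
      case False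
      then have "l2_norm M (v m - v n) > 0" using l2_norm_nonneg[of M "v m - v n"] by linarith
      then show ?thesis using * by simp
    qed simp
  qed
  obtain g where g: "g \<in> l2_space M" and g_lim: "(\<lambda>n. l2_norm M (g - v n)) \<longlonglongrightarrow> 0"
  proof (rule l2_complete[of v M, OF v2])
    fix e :: real assume "e > 0"
    then have "e / 2 > 0" by simp
    then obtain K where K: "\<And>n. n \<ge> K \<Longrightarrow> l2_norm M (f - u n) < e / 2"
      using order_tendstoD(2)[OF u_lim] unfolding eventually_sequentially by metis
    have "l2_norm M (v m - v n) < e" if "m \<ge> K" "n \<ge> K" for m n
    proof -
      have "l2_norm M (u m - u n) \<le> l2_norm M (u m - f) + l2_norm M (f - u n)"
        by (intro l2_dist_triangle u f)
      then show ?thesis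
        using v_u[of m n] K[OF that(1)] K[OF that(2)] l2_norm_minus_commute[of M "u m" f] by simp
    qed
    then show "\<exists>N. \<forall>m\<ge>N. \<forall>n\<ge>N. l2_norm M (v m - v n) < e" by blast
  qed
  have gA: "g \<in> A i" by (rule l2_closed_limit[OF closed[OF i] g v g_lim])
  have "l2_inner M (f - g) a = 0" if a: "a \<in> A i" for a
  proof -
    note a2 = mem_l2[OF i a]
    have "cmod (l2_inner M (f - g) a) \<le> (l2_norm M (f - u n) + l2_norm M (g - v n)) * l2_norm M a" for n
    proof -
      have "l2_inner M (f - g) a = l2_inner M (f - u n) a - l2_inner M (g - v n) a"
        using inner_v[OF a, of n] by (simp add: l2_inner_diff_left f g u v2 a2)
      also have "cmod \<dots> \<le> cmod (l2_inner M (f - u n) a) + cmod (l2_inner M (g - v n) a)"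
        by (rule norm_triangle_ineq4)
      also have "\<dots> \<le> l2_norm M (f - u n) * l2_norm M a + l2_norm M (g - v n) * l2_norm M a"
        by (intro add_mono l2_Cauchy_Schwarz l2_space_diff f g u v2 a2)
      finally show ?thesis by (simp add: distrib_right)
    qed
    moreover have "(\<lambda>n. (l2_norm M (f - u n) + l2_norm M (g - v n)) * l2_norm M a) \<longlonglongrightarrow> 0"
      using u_lim g_lim by (auto intro!: tendsto_eq_intros)
    ultimately have "cmod (l2_inner M (f - g) a) \<le> 0"
      by (intro LIMSEQ_le_const) auto
    then show ?thesis by simp
  qed
  with gA show ?thesis by blast
qed

text \<open>
  The projections \<open>g i\<close> of \<open>f\<close> sum up to \<open>f\<close>: by the best approximation property the
  distance of \<open>f\<close> from \<open>\<Sum>\<^sub>i\<^sub>\<in>\<^sub>G g i\<close> is at most its distance from any sum of elements of the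
  summands with index in \<open>F \<subseteq> G\<close>.
\<close>

theorem orthogonal_decomposition_if_approximable:
  assumes dense: "\<And>f e. f \<in> l2_space M \<Longrightarrow> e > 0 \<Longrightarrow> \<exists>F h. finite F \<and> F \<subseteq> I \<and>
      (\<forall>i\<in>F. h i \<in> A i) \<and> l2_norm M (f - (\<Sum>i\<in>F. h i)) < e"
  shows "l2_orthogonal_decomposition M I A"
  unfolding l2_orthogonal_decomposition_def
proof (intro conjI)
  show "\<forall>f\<in>l2_space M. \<exists>g. (\<forall>i\<in>I. g i \<in> A i) \<and> l2_has_sum M g I f \<and>
      ((\<lambda>i. (l2_norm M (g i))\<^sup>2) has_sum (l2_norm M f)\<^sup>2) I \<and>
      (\<forall>h. (\<forall>i\<in>I. h i \<in> A i) \<and> l2_has_sum M h I f \<longrightarrow>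
        (\<forall>i\<in>I. AE x in M. h i x = g i x))"
  proof
    fix f assume f: "f \<in> l2_space M"
    obtain g where g: "\<And>i. i \<in> I \<Longrightarrow> g i \<in> A i"
        and proj: "\<And>i a. i \<in> I \<Longrightarrow> a \<in> A i \<Longrightarrow> l2_inner M (f - g i) a = 0"
      using projection_exists[OF dense f] by metis
    have zero: "0 \<in> A i" if "i \<in> I" for i
      using cfun.subspace_0[OF l2_closed_subspaceD(1)[OF closed[OF that]]] .
    have sum: "l2_has_sum M g I f"
      unfolding l2_has_sum_iff
    proof (rule tendstoI)
      fix e :: real assume "e > 0"
      from dense[OF f this] obtain F h where Fh: "finite F" "F \<subseteq> I" "\<forall>i\<in>F. h i \<in> A i"
          "l2_norm M (f - (\<Sum>i\<in>F. h i)) < e" by blast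
      show "\<forall>\<^sub>F G in finite_subsets_at_top I. dist (l2_norm M (f - (\<Sum>i\<in>G. g i))) 0 < e"
        unfolding eventually_finite_subsets_at_top
      proof (intro exI[of _ F] conjI allI impI)
        fix G assume G: "finite G \<and> F \<subseteq> G \<and> G \<subseteq> I"
        define h' where "h' i = (if i \<in> F then h i else 0)" for i
        have "(\<Sum>i\<in>G. h' i) = (\<Sum>i\<in>F. h i)"
          unfolding h'_def using G by (subst sum.If_cases) (auto simp: Int_absorb1 Int_absorb2)
        moreover have "(l2_norm M (f - (\<Sum>i\<in>G. h' i)))\<^sup>2 =
            (l2_norm M (f - (\<Sum>i\<in>G. g i)))\<^sup>2 + (\<Sum>i\<in>G. (l2_norm M (g i - h' i))\<^sup>2)"
          using G Fh zero g proj by (intro best_approximation f) (auto simp: h'_def)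
        ultimately have "(l2_norm M (f - (\<Sum>i\<in>G. g i)))\<^sup>2 \<le> (l2_norm M (f - (\<Sum>i\<in>F. h i)))\<^sup>2"
          by (simp add: sum_nonneg)
        then have "l2_norm M (f - (\<Sum>i\<in>G. g i)) \<le> l2_norm M (f - (\<Sum>i\<in>F. h i))"
          by (rule power2_le_imp_le) simp
        then show "dist (l2_norm M (f - (\<Sum>i\<in>G. g i))) 0 < e" using Fh by simp
      qed (use Fh in auto)
    qed
    have "((\<lambda>F. (l2_norm M f)\<^sup>2 - (l2_norm M (f - (\<Sum>i\<in>F. g i)))\<^sup>2)
        \<longlongrightarrow> (l2_norm M f)\<^sup>2 - 0\<^sup>2) (finite_subsets_at_top I)"
      using sum unfolding l2_has_sum_iff by (intro tendsto_intros)
    moreover have "\<forall>\<^sub>F F in finite_subsets_at_top I.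
        (l2_norm M f)\<^sup>2 - (l2_norm M (f - (\<Sum>i\<in>F. g i)))\<^sup>2 = (\<Sum>i\<in>F. (l2_norm M (g i))\<^sup>2)"
      unfolding eventually_finite_subsets_at_top
    proof (intro exI[of _ "{}"] conjI allI impI)
      fix F assume F: "finite F \<and> {} \<subseteq> F \<and> F \<subseteq> I"
      show "(l2_norm M f)\<^sup>2 - (l2_norm M (f - (\<Sum>i\<in>F. g i)))\<^sup>2 = (\<Sum>i\<in>F. (l2_norm M (g i))\<^sup>2)"
        using best_approximation[of F f g "\<lambda>_. 0"] F f g proj zero by (auto simp: subset_iff)
    qed auto
    ultimately have norm: "((\<lambda>i. (l2_norm M (g i))\<^sup>2) has_sum (l2_norm M f)\<^sup>2) I"
      unfolding has_sum_def by (simp add: tendsto_cong)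
    show "\<exists>g. (\<forall>i\<in>I. g i \<in> A i) \<and> l2_has_sum M g I f \<and>
      ((\<lambda>i. (l2_norm M (g i))\<^sup>2) has_sum (l2_norm M f)\<^sup>2) I \<and>
      (\<forall>h. (\<forall>i\<in>I. h i \<in> A i) \<and> l2_has_sum M h I f \<longrightarrow>
        (\<forall>i\<in>I. AE x in M. h i x = g i x))"
      using g sum norm has_sum_unique[OF f sum g] by (intro exI[of _ g]) blast
  qed
next
  show "\<forall>i\<in>I. l2_closed_subspace M (A i)" using closed by blast
  show "\<forall>i\<in>I. \<forall>j\<in>I. i \<noteq> j \<longrightarrow> (\<forall>f\<in>A i. \<forall>g\<in>A j. l2_inner M f g = 0)"
    using orth by blast
  show "\<forall>g. (\<forall>i\<in>I. g i \<in> A i) \<and> (\<lambda>i. (l2_norm M (g i))\<^sup>2) summable_on I \<longrightarrow>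
      (\<exists>f\<in>l2_space M. l2_has_sum M g I f)"
    by (intro allI impI summable_imp_has_sum) auto
qed

text \<open>
  The components \<open>h i\<close> are chosen for all \<open>i\<close> and vanish outside \<open>F\<close>; two such representations
  can then be added over the union of their index sets.
\<close>

lemma span_Union_finite_sum:
  assumes "g \<in> cfun.span (\<Union>i\<in>I. A i)"
  shows "\<exists>F h. finite F \<and> F \<subseteq> I \<and> (\<forall>i\<in>I. h i \<in> A i) \<and> (\<forall>i. i \<notin> F \<longrightarrow> h i = 0) \<and>
    g = (\<Sum>i\<in>F. h i)" (is "?P g")
  using assms
proof (induction rule: cfun.span_induct)
  have sub: "cfun.subspace (A i)" if "i \<in> I" for i
    using l2_closed_subspaceD(1)[OF closed[OF that]] .
  {
    case base
    show ?case
    proof (rule cfun.subspaceI)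
      have zero: "\<forall>i\<in>I. 0 \<in> A i" using cfun.subspace_0[OF sub] by blast
      have "?P 0"
        by (intro exI[of _ "{}"] exI[of _ "\<lambda>_. 0"] conjI zero) simp_all
      then show "0 \<in> Collect ?P" by (simp only: mem_Collect_eq)
    next
      fix g1 g2 assume g1: "g1 \<in> Collect ?P" and g2: "g2 \<in> Collect ?P"
      from g1[unfolded mem_Collect_eq] obtain F1 h1 where
        1: "finite F1" "F1 \<subseteq> I" "\<forall>i\<in>I. h1 i \<in> A i" "\<forall>i. i \<notin> F1 \<longrightarrow> h1 i = 0"
          "g1 = (\<Sum>i\<in>F1. h1 i)" by blast
      from g2[unfolded mem_Collect_eq] obtain F2 h2 where
        2: "finite F2" "F2 \<subseteq> I" "\<forall>i\<in>I. h2 i \<in> A i" "\<forall>i. i \<notin> F2 \<longrightarrow> h2 i = 0"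
          "g2 = (\<Sum>i\<in>F2. h2 i)" by blast
      have "g1 = (\<Sum>i\<in>F1 \<union> F2. h1 i)" "g2 = (\<Sum>i\<in>F1 \<union> F2. h2 i)"
        unfolding 1(5) 2(5) using 1 2 by (intro sum.mono_neutral_left; simp)+
      then have "g1 + g2 = (\<Sum>i\<in>F1 \<union> F2. h1 i + h2 i)" by (simp only: sum.distrib)
      moreover have "finite (F1 \<union> F2)" "F1 \<union> F2 \<subseteq> I" "\<forall>i\<in>I. h1 i + h2 i \<in> A i"
          "\<forall>i. i \<notin> F1 \<union> F2 \<longrightarrow> h1 i + h2 i = 0"
        using 1 2 cfun.subspace_add[OF sub] by auto
      ultimately have "?P (g1 + g2)"
        by (intro exI[of _ "F1 \<union> F2"] exI[of _ "\<lambda>i. h1 i + h2 i"] conjI)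
      then show "g1 + g2 \<in> Collect ?P" by (simp only: mem_Collect_eq)
    next
      fix c g1 assume g1: "g1 \<in> Collect ?P"
      from g1[unfolded mem_Collect_eq] obtain F1 h1 where
        1: "finite F1" "F1 \<subseteq> I" "\<forall>i\<in>I. h1 i \<in> A i" "\<forall>i. i \<notin> F1 \<longrightarrow> h1 i = 0"
          "g1 = (\<Sum>i\<in>F1. h1 i)" by blast
      have "fun_scale c g1 = (\<Sum>i\<in>F1. fun_scale c (h1 i))"
        unfolding 1(5) by (rule cfun.scale_sum_right)
      moreover have "\<forall>i\<in>I. fun_scale c (h1 i) \<in> A i" "\<forall>i. i \<notin> F1 \<longrightarrow> fun_scale c (h1 i) = 0"
        using 1 cfun.subspace_scale[OF sub] by auto
      ultimately have "?P (fun_scale c g1)"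
        using 1(1,2) by (intro exI[of _ F1] exI[of _ "\<lambda>i. fun_scale c (h1 i)"] conjI)
      then show "fun_scale c g1 \<in> Collect ?P" by (simp only: mem_Collect_eq)
    qed
  next
    case (step x)
    then obtain i where i: "i \<in> I" "x \<in> A i" by auto
    show ?case
      by (rule exI[of _ "{i}"], rule exI[of _ "\<lambda>j. if j = i then x else 0"])
        (use i cfun.subspace_0[OF sub] in simp)
  }
qed

theorem orthogonal_decomposition_if_total:
  assumes total: "l2_closure M (cfun.span (\<Union>i\<in>I. A i)) = l2_space M"
  shows "l2_orthogonal_decomposition M I A"
proof (rule orthogonal_decomposition_if_approximable)
  fix f and e :: real assume f: "f \<in> l2_space M" and e: "e > 0"
  have "f \<in> l2_closure M (cfun.span (\<Union>i\<in>I. A i))" unfolding total by (rule f)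
  then have "\<exists>g. g \<in> cfun.span (\<Union>i\<in>I. A i) \<and> g \<in> l2_space M \<and> l2_norm M (f - g) < e"
    using e by (simp only: l2_closure_iff)
  then obtain g where g: "g \<in> cfun.span (\<Union>i\<in>I. A i)" "l2_norm M (f - g) < e"
    by (elim exE conjE)
  from span_Union_finite_sum[OF g(1)] obtain F h where h: "finite F" "F \<subseteq> I"
      "\<forall>i\<in>I. h i \<in> A i" "g = (\<Sum>i\<in>F. h i)" by (elim exE conjE)
  have "\<forall>i\<in>F. h i \<in> A i" using h by blast
  moreover have "l2_norm M (f - (\<Sum>i\<in>F. h i)) < e" using g(2) by (simp only: h(4))
  ultimately show "\<exists>F h. finite F \<and> F \<subseteq> I \<and> (\<forall>i\<in>F. h i \<in> A i) \<and> l2_norm M (f - (\<Sum>i\<in>F. h i)) < e"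
    using h(1,2) by (intro exI[of _ F] exI[of _ h] conjI)
qed

end

section \<open>Planar Lebesgue measure\<close>

lemma borel_measurable_Complex [measurable (raw)]:
  assumes [measurable]: "f \<in> borel_measurable M" "g \<in> borel_measurable M"
  shows "(\<lambda>x. Complex (f x) (g x)) \<in> borel_measurable M"
  unfolding Complex_eq by measurable

text \<open>
  Both measures give an open rectangle the product of its side lengths.
\<close>

lemma lborel_complex:
  "lborel = distr (lborel \<Otimes>\<^sub>M lborel) borel (\<lambda>p. Complex (fst p) (snd p))"
proof (rule lborel_eqI)
  have meas: "(\<lambda>p :: real \<times> real. Complex (fst p) (snd p)) \<in> borel_measurable (lborel \<Otimes>\<^sub>M lborel)"
    by measurable
  fix l u :: complex
  assume le: "\<And>b. b \<in> Basis \<Longrightarrow> l \<bullet> b \<le> u \<bullet> b"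
  have le': "Re l \<le> Re u" "Im l \<le> Im u"
    using le[of 1] le[of \<i>] by (auto simp: Basis_complex_def)
  have "(\<lambda>p. Complex (fst p) (snd p)) -` box l u \<inter> space (lborel \<Otimes>\<^sub>M lborel)
      = {Re l<..<Re u} \<times> {Im l<..<Im u}"
    by (auto simp: box_def Basis_complex_def space_pair_measure)
  then have "emeasure (distr (lborel \<Otimes>\<^sub>M lborel) borel (\<lambda>p. Complex (fst p) (snd p))) (box l u)
      = emeasure (lborel \<Otimes>\<^sub>M lborel) ({Re l<..<Re u} \<times> {Im l<..<Im u})"
    by (simp add: emeasure_distr[OF meas])
  also have "\<dots> = ennreal (Re u - Re l) * ennreal (Im u - Im l)"
    by (subst lborel.emeasure_pair_measure_Times) (auto simp: le')
  also have "\<dots> = (\<Prod>b\<in>Basis. (u - l) \<bullet> b)"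
    using le' by (simp add: Basis_complex_def ennreal_mult)
  finally show "emeasure (distr (lborel \<Otimes>\<^sub>M lborel) borel (\<lambda>p. Complex (fst p) (snd p))) (box l u)
      = (\<Prod>b\<in>Basis. (u - l) \<bullet> b)" .
qed simp

lemma nn_integral_lborel_complex:
  fixes f :: "complex \<Rightarrow> ennreal"
  assumes [measurable]: "f \<in> borel_measurable borel"
  shows "(\<integral>\<^sup>+z. f z \<partial>lborel) = (\<integral>\<^sup>+x. \<integral>\<^sup>+y. f (Complex x y) \<partial>lborel \<partial>lborel)"
    and "(\<integral>\<^sup>+z. f z \<partial>lborel) = (\<integral>\<^sup>+y. \<integral>\<^sup>+x. f (Complex x y) \<partial>lborel \<partial>lborel)"
proof -
  have eq: "(\<integral>\<^sup>+z. f z \<partial>lborel) = (\<integral>\<^sup>+p. f (Complex (fst p) (snd p)) \<partial>(lborel \<Otimes>\<^sub>M lborel))"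
    by (subst lborel_complex, subst nn_integral_distr) measurable
  show "(\<integral>\<^sup>+z. f z \<partial>lborel) = (\<integral>\<^sup>+x. \<integral>\<^sup>+y. f (Complex x y) \<partial>lborel \<partial>lborel)"
    unfolding eq by (subst lborel.nn_integral_fst[symmetric]) auto
  show "(\<integral>\<^sup>+z. f z \<partial>lborel) = (\<integral>\<^sup>+y. \<integral>\<^sup>+x. f (Complex x y) \<partial>lborel \<partial>lborel)"
    unfolding eq by (subst lborel_pair.nn_integral_snd[symmetric]) auto
qed

text \<open>
  A shear is a translation in one coordinate when the other one is fixed.
\<close>

lemma nn_integral_lborel_shear:
  fixes f :: "complex \<Rightarrow> ennreal"
  assumes [measurable]: "f \<in> borel_measurable borel"
  shows "(\<integral>\<^sup>+z. f (Complex (Re z + a * Im z) (Im z)) \<partial>lborel) = (\<integral>\<^sup>+z. f z \<partial>lborel)"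
    and "(\<integral>\<^sup>+z. f (Complex (Re z) (Im z + a * Re z)) \<partial>lborel) = (\<integral>\<^sup>+z. f z \<partial>lborel)"
proof -
  have shift: "(\<integral>\<^sup>+x. g (x + t) \<partial>lborel) = (\<integral>\<^sup>+x. g x \<partial>lborel)"
    if "g \<in> borel_measurable borel" for g :: "real \<Rightarrow> ennreal" and t
    using nn_integral_real_affine[OF that, of 1 t] by (simp add: add.commute)
  show "(\<integral>\<^sup>+z. f (Complex (Re z + a * Im z) (Im z)) \<partial>lborel) = (\<integral>\<^sup>+z. f z \<partial>lborel)"
    by (simp add: nn_integral_lborel_complex(2) shift[of "\<lambda>x. f (Complex x _)"])
  show "(\<integral>\<^sup>+z. f (Complex (Re z) (Im z + a * Re z)) \<partial>lborel) = (\<integral>\<^sup>+z. f z \<partial>lborel)"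
    by (simp add: nn_integral_lborel_complex(1) shift[of "\<lambda>y. f (Complex _ y)"])
qed

text \<open>
  A rotation is a composition of three shears unless it is multiplication by \<open>1\<close> or \<open>-1\<close>, and
  \<open>-1 = \<i> \<cdot> \<i>\<close>.
\<close>

lemma nn_integral_lborel_rotation:
  fixes f :: "complex \<Rightarrow> ennreal"
  assumes f: "f \<in> borel_measurable borel" and \<omega>: "cmod \<omega> = 1"
  shows "(\<integral>\<^sup>+z. f (\<omega> * z) \<partial>lborel) = (\<integral>\<^sup>+z. f z \<partial>lborel)"
proof -
  have three_shears: "(\<integral>\<^sup>+z. f (\<omega> * z) \<partial>lborel) = (\<integral>\<^sup>+z. f z \<partial>lborel)"
    if f[measurable]: "f \<in> borel_measurable borel" and "cmod \<omega> = 1" and s: "Im \<omega> \<noteq> 0"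
    for f :: "complex \<Rightarrow> ennreal" and \<omega>
  proof -
    \<comment> \<open>For \<open>\<omega> = exp(\<i> \<alpha>)\<close> this is \<open>- tan(\<alpha>/2)\<close>, the slope of the outer two shears.\<close>
    define a where "a = (Re \<omega> - 1) / Im \<omega>"
    have "(Re \<omega>)\<^sup>2 + (Im \<omega>)\<^sup>2 = 1"
      using that(2) by (simp add: cmod_def)
    then have a_eq: "a * (Re \<omega> + 1) = - Im \<omega>"
      using s by (simp add: a_def field_simps power2_eq_square)
    have a_s: "a * Im \<omega> = Re \<omega> - 1" using s by (simp add: a_def)
    define S where "S z = Complex (Re z + a * Im z) (Im z)" for z
    define T where "T z = Complex (Re z) (Im z + Im \<omega> * Re z)" for z
    have [measurable]: "S \<in> borel_measurable borel" "T \<in> borel_measurable borel"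
      unfolding S_def[abs_def] T_def[abs_def] by measurable
    have "S (T (S z)) = \<omega> * z" for z
    proof (rule complex_eqI)
      have "Im (S (T (S z))) = Im z * (1 + a * Im \<omega>) + Im \<omega> * Re z"
        by (simp add: S_def T_def algebra_simps)
      then show "Im (S (T (S z))) = Im (\<omega> * z)"
        by (simp add: a_s algebra_simps)
      have "Re (S (T (S z))) = Re z * (1 + a * Im \<omega>) + Im z * (a * (1 + (1 + a * Im \<omega>)))"
        by (simp add: S_def T_def algebra_simps)
      also have "\<dots> = Re z * Re \<omega> + Im z * (a * (Re \<omega> + 1))"
        by (simp add: a_s algebra_simps)
      also have "\<dots> = Re z * Re \<omega> + Im z * (- Im \<omega>)"
        by (simp only: a_eq)
      finally show "Re (S (T (S z))) = Re (\<omega> * z)"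
        by (simp add: mult.commute)
    qed
    then have "(\<integral>\<^sup>+z. f (\<omega> * z) \<partial>lborel) = (\<integral>\<^sup>+z. f (S (T (S z))) \<partial>lborel)"
      by simp
    also have "\<dots> = (\<integral>\<^sup>+z. f (S (T z)) \<partial>lborel)"
      unfolding S_def[of "_ :: complex"] 
      using nn_integral_lborel_shear(1)[of "\<lambda>z. f (S (T z))" a] by (simp add: S_def)
    also have "\<dots> = (\<integral>\<^sup>+z. f (S z) \<partial>lborel)"
      using nn_integral_lborel_shear(2)[of "\<lambda>z. f (S z)" "Im \<omega>"] by (simp add: T_def)
    also have "\<dots> = (\<integral>\<^sup>+z. f z \<partial>lborel)"
      using nn_integral_lborel_shear(1)[of f a] by (simp add: S_def)
    finally show ?thesis .
  qed
  show ?thesis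
  proof (cases "Im \<omega> = 0")
    case False
    then show ?thesis by (rule three_shears[OF f \<omega>])
  next
    case True
    then have "\<bar>Re \<omega>\<bar> = 1" using \<omega> by (simp add: cmod_def)
    with True have "\<omega> = 1 \<or> \<omega> = -1" by (auto simp: complex_eq_iff abs_if split: if_splits)
    then show ?thesis
    proof
      assume "\<omega> = -1"
      have "(\<integral>\<^sup>+z. f (\<i> * (\<i> * z)) \<partial>lborel) = (\<integral>\<^sup>+z. f (\<i> * z) \<partial>lborel)"
      proof (rule three_shears[of "\<lambda>z. f (\<i> * z)"])
        show "(\<lambda>z. f (\<i> * z)) \<in> borel_measurable borel" using f by measurable
      qed auto
      also have "\<dots> = (\<integral>\<^sup>+z. f z \<partial>lborel)"
        by (rule three_shears[OF f]) auto
      finally show ?thesis using \<open>\<omega> = -1\<close> by (simp flip: mult.assoc)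
    qed simp
  qed
qed

lemma lborel_distr_rotation:
  assumes "cmod \<omega> = 1"
  shows "distr lborel borel ((*) \<omega>) = (lborel :: complex measure)"
proof (rule measure_eqI)
  fix X :: "complex set" assume "X \<in> sets (distr lborel borel ((*) \<omega>))"
  then have X[measurable]: "X \<in> sets borel" by simp
  have "emeasure (distr lborel borel ((*) \<omega>)) X = (\<integral>\<^sup>+z. indicator X z \<partial>distr lborel borel ((*) \<omega>))"
    by simp
  also have "\<dots> = (\<integral>\<^sup>+z. indicator X (\<omega> * z) \<partial>lborel)"
    by (rule nn_integral_distr) measurable
  also have "\<dots> = (\<integral>\<^sup>+z. indicator X z \<partial>lborel)"
    by (rule nn_integral_lborel_rotation[OF _ assms]) measurable
  finally show "emeasure (distr lborel borel ((*) \<omega>)) X = emeasure lborel X" by simp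
qed simp

text \<open>
  The disc \<open>{z. \<bar>z\<bar>\<^sup>2 \<le> t}\<close> has area \<open>\<pi> t\<close>. For radial functions this is integration in polar coordinates.
\<close>

lemma distr_cmod_square:
  "distr lborel borel (\<lambda>z :: complex. (cmod z)\<^sup>2) = density lborel (\<lambda>t. ennreal pi * indicator {0..} t)"
proof (rule measure_eqI_generator_eq[where E = "range (\<lambda>t::real. {..t})" and \<Omega> = UNIV
      and A = "\<lambda>n. {..real n}"])
  show "Int_stable (range (\<lambda>t::real. {..t}))"
    by (auto simp: Int_stable_def)
  show "sets (distr lborel borel (\<lambda>z :: complex. (cmod z)\<^sup>2)) = sigma_sets UNIV (range (\<lambda>t. {..t}))"
    unfolding sets_distr by (subst borel_eq_atMost) simp
  show "sets (density lborel (\<lambda>t. ennreal pi * indicator {0..} t)) = sigma_sets UNIV (range (\<lambda>t::real. {..t}))"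
    unfolding sets_density sets_lborel by (subst borel_eq_atMost) simp
  have vol: "emeasure (distr lborel borel (\<lambda>z :: complex. (cmod z)\<^sup>2)) {..t} = ennreal (pi * max 0 t)" for t
  proof -
    have "emeasure (distr lborel borel (\<lambda>z :: complex. (cmod z)\<^sup>2)) {..t}
        = emeasure lborel ((\<lambda>z :: complex. (cmod z)\<^sup>2) -` {..t})"
      by (subst emeasure_distr) auto
    also have "\<dots> = ennreal (pi * max 0 t)"
    proof (cases "t \<ge> 0")
      case True
      have "(cmod z)\<^sup>2 \<le> t \<longleftrightarrow> cmod z \<le> sqrt t" for z
        using real_sqrt_le_iff[of "(cmod z)\<^sup>2" t] by simp
      then have "(\<lambda>z :: complex. (cmod z)\<^sup>2) -` {..t} = cball 0 (sqrt t)"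
        by auto
      then show ?thesis
        using emeasure_cball[of "sqrt t" "0 :: complex"] True by (simp add: unit_ball_vol_2)
    next
      case False
      then have "(\<lambda>z :: complex. (cmod z)\<^sup>2) -` {..t} = {}"
        by (auto simp: not_le dest: order_trans[OF zero_le_power2])
      then show ?thesis using False by simp
    qed
    finally show ?thesis .
  qed
  show "emeasure (distr lborel borel (\<lambda>z :: complex. (cmod z)\<^sup>2)) X
      = emeasure (density lborel (\<lambda>t. ennreal pi * indicator {0..} t)) X"
    if X: "X \<in> range (\<lambda>t. {..t})" for X
  proof -
    obtain t where t: "X = {..t}" using X by auto
    have "emeasure (density lborel (\<lambda>t. ennreal pi * indicator {0..} t)) {..t}
        = (\<integral>\<^sup>+x. ennreal pi * indicator {0..} x * indicator {..t} x \<partial>lborel)"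
      by (rule emeasure_density) auto
    also have "\<dots> = (\<integral>\<^sup>+x. ennreal pi * indicator {0..t} x \<partial>lborel)"
      by (intro nn_integral_cong) (auto simp: indicator_def)
    also have "\<dots> = ennreal (pi * max 0 t)"
      by (simp add: nn_integral_cmult max_def ennreal_mult)
    finally show ?thesis by (simp add: t vol)
  qed
  show "(\<Union>n. {..real n}) = UNIV" by (auto intro: real_arch_simple)
  show "emeasure (distr lborel borel (\<lambda>z :: complex. (cmod z)\<^sup>2)) {..real n} \<noteq> \<infinity>" for n
    by (simp add: vol)
qed auto

lemma nn_integral_radial:
  assumes [measurable]: "g \<in> borel_measurable borel"
  shows "(\<integral>\<^sup>+z. g ((cmod (z::complex))\<^sup>2) \<partial>lborel) = ennreal pi * (\<integral>\<^sup>+t. g t * indicator {0..} t \<partial>lborel)"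
proof -
  have "(\<integral>\<^sup>+z. g ((cmod (z::complex))\<^sup>2) \<partial>lborel)
      = (\<integral>\<^sup>+t. g t \<partial>distr lborel borel (\<lambda>z :: complex. (cmod z)\<^sup>2))"
    by (subst nn_integral_distr) measurable
  also have "\<dots> = (\<integral>\<^sup>+t. ennreal pi * (g t * indicator {0..} t) \<partial>lborel)"
    unfolding distr_cmod_square
    by (subst nn_integral_density) (auto simp: mult_ac)
  also have "\<dots> = ennreal pi * (\<integral>\<^sup>+t. g t * indicator {0..} t \<partial>lborel)"
    by (rule nn_integral_cmult) measurable
  finally show ?thesis .
qed

section \<open>The radial part of the fractional Zernike functions\<close>

lemma local_power_diff_1:
  assumes "z \<noteq> 0" "w \<noteq> 0"
  shows "local_power z (a - 1) w = local_power z a w / w"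
proof -
  have "exp (Ln z + Ln (w / z)) = w" using assms by (simp add: exp_add)
  then show ?thesis
    by (simp add: local_power_def left_diff_distrib exp_diff)
qed

lemma local_power_self_add:
  assumes "z \<noteq> 0"
  shows "local_power z a z * local_power z b z = local_power z (a + b) z"
  by (simp add: local_power_def exp_add distrib_right)

lemma has_field_derivative_local_power:
  assumes "z \<noteq> 0" "w / z \<notin> \<real>\<^sub>\<le>\<^sub>0"
  shows "(local_power z a has_field_derivative of_real a * local_power z a w / w) (at w)"
proof -
  have "w \<noteq> 0" using assms by auto
  then show ?thesis
    unfolding local_power_def[abs_def]
    by (auto intro!: derivative_eq_intros assms simp: assms(1))
qed

text \<open>
  Product rule, as \<open>\<partial>f/\<partial>z = f'\<close> for holomorphic \<open>f\<close> and \<open>\<partial>\<bar>z\<bar>\<^sup>2/\<partial>z\<close> is the conjugate of \<open>z\<close>. The open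
  set \<open>U\<close> allows for iteration, where \<open>F\<close> is known only on the domain of a local branch.
\<close>

lemma wirtinger_holomorphic_times_radial:
  assumes f: "(f has_field_derivative f') (at w)"
    and \<phi>: "(\<phi> has_real_derivative \<phi>') (at ((cmod w)\<^sup>2))"
    and U: "open U" "w \<in> U" "\<And>v. v \<in> U \<Longrightarrow> F v = f v * of_real (\<phi> ((cmod v)\<^sup>2))"
  shows "wirtinger F w = f' * of_real (\<phi> ((cmod w)\<^sup>2)) + f w * of_real \<phi>' * cnj w"
proof -
  have "((\<lambda>v. (Re v)\<^sup>2 + (Im v)\<^sup>2) has_derivative (\<lambda>h. 2 * (Re w * Re h + Im w * Im h))) (at w)"
    by (auto intro!: derivative_eq_intros simp: algebra_simps)
  then have "((\<lambda>v. (cmod v)\<^sup>2) has_derivative (\<lambda>h. 2 * (Re w * Re h + Im w * Im h))) (at w)"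
    by (simp add: cmod_power2)
  from DERIV_compose_FDERIV[OF \<phi> this]
  have "((\<lambda>v. \<phi> ((cmod v)\<^sup>2)) has_derivative (\<lambda>h. 2 * (Re w * Re h + Im w * Im h) * \<phi>')) (at w)" .
  from has_derivative_mult[OF has_field_derivative_imp_has_derivative[OF f] has_derivative_of_real[OF this]]
  have "((\<lambda>v. f v * of_real (\<phi> ((cmod v)\<^sup>2))) has_derivative
      (\<lambda>h. f w * of_real (2 * (Re w * Re h + Im w * Im h) * \<phi>') + f' * h * of_real (\<phi> ((cmod w)\<^sup>2)))) (at w)" .
  then have "(F has_derivative
      (\<lambda>h. f w * of_real (2 * (Re w * Re h + Im w * Im h) * \<phi>') + f' * h * of_real (\<phi> ((cmod w)\<^sup>2)))) (at w)"
    by (rule has_derivative_transform_within_open[OF _ U(1,2)]) (simp add: U(3))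
  from frechet_derivative_at[OF this, symmetric]
  have "wirtinger F w = (f w * of_real (2 * Re w * \<phi>') + f' * of_real (\<phi> ((cmod w)\<^sup>2))
      - \<i> * (f w * of_real (2 * Im w * \<phi>') + f' * \<i> * of_real (\<phi> ((cmod w)\<^sup>2)))) / 2"
    by (simp add: wirtinger_def)
  also have "\<dots> = f' * of_real (\<phi> ((cmod w)\<^sup>2)) + f w * of_real \<phi>' * (of_real (Re w) - \<i> * of_real (Im w))"
    by (simp add: field_simps)
  also have "of_real (Re w) - \<i> * of_real (Im w) = cnj w"
    by (simp add: complex_eq_iff)
  finally show ?thesis .
qed

text \<open>
  The polynomial factor \<open>q\<^sub>k\<close> in \<open>\<partial>\<^sup>k/\<partial>z\<^sup>k (z\<^sup>a (1 - t)\<^sup>b) = z\<^sup>a\<^sup>-\<^sup>k (1 - t)\<^sup>b\<^sup>-\<^sup>k q\<^sub>k(t)\<close>, where \<open>t = \<bar>z\<bar>\<^sup>2\<close>. Multiplication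
  by \<open>t\<close> is \<open>pCons 0\<close>; the recursion is the one in \<open>poly_rodrigues_Suc\<close>. Up to normalisation
  \<open>q\<^sub>m\<close> is a shifted Jacobi polynomial if \<open>a = m + \<rho>\<close> and \<open>b = \<kappa> + m\<close>.
\<close>

primrec rodrigues_poly :: "real \<Rightarrow> real \<Rightarrow> nat \<Rightarrow> real poly" where
  "rodrigues_poly a b 0 = 1"
| "rodrigues_poly a b (Suc k) =
    (let q = rodrigues_poly a b k in
      smult (a - real k) (q - pCons 0 q) - smult (b - real k) (pCons 0 q)
      + (pCons 0 (pderiv q) - pCons 0 (pCons 0 (pderiv q))))"

lemma poly_rodrigues_Suc:
  "poly (rodrigues_poly a b (Suc k)) t =
    (a - real k) * (1 - t) * poly (rodrigues_poly a b k) t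
    - (b - real k) * t * poly (rodrigues_poly a b k) t
    + t * (1 - t) * poly (pderiv (rodrigues_poly a b k)) t"
  by (simp add: Let_def algebra_simps)

text \<open>
  The coefficient of \<open>t\<^sup>k\<^sup>+\<^sup>1\<close> in the recursion collects \<open>-(a - k)\<close>, \<open>-(b - k)\<close> and \<open>-k\<close>, the last one
  from the derivative, times the leading coefficient of the previous polynomial.
\<close>

lemma rodrigues_poly_coeffs:
  "degree (rodrigues_poly a b k) \<le> k \<and>
    coeff (rodrigues_poly a b k) k = (-1) ^ k * (\<Prod>i<k. a + b - real i)"
proof (induction k)
  case (Suc k)
  define q where "q = rodrigues_poly a b k"
  have q: "coeff q j = 0" if "j > k" for j
    using Suc that by (simp add: q_def coeff_eq_0)
  have lead: "coeff q k = (-1) ^ k * (\<Prod>i<k. a + b - real i)"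
    using Suc by (simp add: q_def)
  have eq: "rodrigues_poly a b (Suc k) =
      smult (a - real k) (q - pCons 0 q) - smult (b - real k) (pCons 0 q)
      + (pCons 0 (pderiv q) - pCons 0 (pCons 0 (pderiv q)))"
    by (simp add: q_def Let_def)
  have "degree (rodrigues_poly a b (Suc k)) \<le> Suc k"
    unfolding eq
    by (rule degree_le) (auto simp: q coeff_pCons coeff_pderiv split: nat.split)
  moreover have "coeff (rodrigues_poly a b (Suc k)) (Suc k) = - (a + b - real k) * coeff q k"
    unfolding eq
    by (cases k) (auto simp: q coeff_pCons coeff_pderiv algebra_simps split: nat.split)
  ultimately show ?case by (simp add: lead algebra_simps del: rodrigues_poly.simps)
qed simp

text \<open>
  The formula is proved on the slit disc where the branch of the power near \<open>z\<close> is holomorphic. It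
  is open, so the formula for \<open>k\<close> can be differentiated.
\<close>

lemma wirtinger_power_Rodrigues:
  assumes z: "z \<noteq> 0" and w: "cmod w < 1" "w / z \<notin> \<real>\<^sub>\<le>\<^sub>0"
  shows "(wirtinger ^^ k) (\<lambda>w. local_power z a w * of_real ((1 - (cmod w)\<^sup>2) powr b)) w =
    local_power z (a - real k) w *
    of_real ((1 - (cmod w)\<^sup>2) powr (b - real k) * poly (rodrigues_poly a b k) ((cmod w)\<^sup>2))"
  using w
proof (induction k arbitrary: w)
  case (Suc k)
  define U where "U = ball 0 1 \<inter> (\<lambda>w. w / z) -` (- \<real>\<^sub>\<le>\<^sub>0)"
  have "open ((\<lambda>w. w / z) -` (- \<real>\<^sub>\<le>\<^sub>0))"
    using z by (intro continuous_open_vimage) (auto intro!: continuous_intros)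
  then have U: "open U" "w \<in> U" using Suc.prems by (auto simp: U_def)
  define q where "q = rodrigues_poly a b k"
  define t where "t = (cmod w)\<^sup>2"
  define c where "c = b - real k"
  have t: "t < 1"
    unfolding t_def using Suc.prems by (simp add: power_less_one_iff abs_square_less_1)
  have w0: "w \<noteq> 0" using Suc.prems by auto
  have "((\<lambda>t. (1 - t) powr c * poly q t) has_real_derivative
      (1 - t) powr (c - 1) * ((1 - t) * poly (pderiv q) t - c * poly q t)) (at t)"
    using t by (auto intro!: derivative_eq_intros simp: powr_diff field_simps)
  then have \<phi>: "((\<lambda>t. (1 - t) powr c * poly q t) has_real_derivative
      (1 - t) powr (c - 1) * ((1 - t) * poly (pderiv q) t - c * poly q t)) (at ((cmod w)\<^sup>2))"
    by (simp add: t_def)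
  have "(wirtinger ^^ Suc k) (\<lambda>w. local_power z a w * of_real ((1 - (cmod w)\<^sup>2) powr b)) w
      = wirtinger ((wirtinger ^^ k) (\<lambda>w. local_power z a w * of_real ((1 - (cmod w)\<^sup>2) powr b))) w"
    by simp
  also have "\<dots> = of_real (a - real k) * local_power z (a - real k) w / w
        * of_real ((1 - (cmod w)\<^sup>2) powr c * poly q ((cmod w)\<^sup>2))
      + local_power z (a - real k) w
        * of_real ((1 - t) powr (c - 1) * ((1 - t) * poly (pderiv q) t - c * poly q t)) * cnj w"
    by (rule wirtinger_holomorphic_times_radial[OF
          has_field_derivative_local_power[OF z Suc.prems(2)] \<phi> U])
      (use Suc.IH in \<open>auto simp: U_def c_def q_def\<close>)
  also have "(1 - (cmod w)\<^sup>2) powr c = (1 - t) powr (c - 1) * (1 - t)"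
    using t by (simp add: t_def powr_diff)
  also have "cnj w = of_real t / w"
    using w0 complex_norm_square[of w] by (simp add: t_def field_simps)
  also have "of_real (a - real k) * local_power z (a - real k) w / w
        * of_real ((1 - t) powr (c - 1) * (1 - t) * poly q ((cmod w)\<^sup>2))
      + local_power z (a - real k) w
        * of_real ((1 - t) powr (c - 1) * ((1 - t) * poly (pderiv q) t - c * poly q t)) * (of_real t / w)
      = (local_power z (a - real k) w / w) * of_real ((1 - t) powr (c - 1) *
        ((a - real k) * (1 - t) * poly q t - c * t * poly q t + t * (1 - t) * poly (pderiv q) t))"
    using w0 by (simp add: t_def field_simps)
  also have "\<dots> = local_power z (a - real (Suc k)) w * of_real ((1 - t) powr (b - real (Suc k)) *
      poly (rodrigues_poly a b (Suc k)) t)"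
    unfolding poly_rodrigues_Suc using local_power_diff_1[OF z w0, of "a - real k"]
    by (simp add: c_def q_def diff_diff_eq add.commute)
  finally show ?case by (simp add: t_def)
qed simp

definition zernike_poly :: "real \<Rightarrow> real \<Rightarrow> nat \<Rightarrow> real poly" where
  "zernike_poly \<kappa> \<rho> m = smult ((-1) ^ m) (rodrigues_poly (real m + \<rho>) (\<kappa> + real m) m)"

text \<open>
  The factors \<open>2 m + \<rho> + \<kappa> - i\<close>, \<open>i < m\<close>, of the leading coefficient are positive, as
  \<open>2 m - i \<ge> m + 1 \<ge> 2\<close> and \<open>\<rho> + \<kappa> > -2\<close>.
\<close>

lemma degree_zernike_poly:
  assumes "\<kappa> > -1" "\<rho> > -1"
  shows "degree (zernike_poly \<kappa> \<rho> m) = m"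
proof -
  have "real m + \<rho> + (\<kappa> + real m) - real i \<noteq> 0" if "i < m" for i
  proof -
    have "real i + 1 \<le> real m" using that by simp
    then show ?thesis using assms by linarith
  qed
  then have "(\<Prod>i<m. real m + \<rho> + (\<kappa> + real m) - real i) \<noteq> 0" by auto
  then have "coeff (rodrigues_poly (real m + \<rho>) (\<kappa> + real m) m) m \<noteq> 0"
    using rodrigues_poly_coeffs[of "real m + \<rho>" "\<kappa> + real m" m] by simp
  then have "degree (rodrigues_poly (real m + \<rho>) (\<kappa> + real m) m) = m"
    using rodrigues_poly_coeffs by (intro le_antisym le_degree) blast+
  then show ?thesis by (simp add: zernike_poly_def)
qed

lemma zernike_eq_poly:
  assumes "z \<noteq> 0" "cmod z < 1"
  shows "zernike \<kappa> \<rho> m (real m) z = of_real (poly (zernike_poly \<kappa> \<rho> m) ((cmod z)\<^sup>2))"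
proof -
  have t: "1 - (cmod z)\<^sup>2 > 0"
    using assms by (simp add: power_less_one_iff abs_square_less_1)
  have z1: "z / z \<notin> \<real>\<^sub>\<le>\<^sub>0" using assms by simp
  have "zernike \<kappa> \<rho> m (real m) z = (-1) ^ m * (local_power z (- \<rho>) z * local_power z \<rho> z)
      * of_real ((1 - (cmod z)\<^sup>2) powr (- \<kappa>) * (1 - (cmod z)\<^sup>2) powr \<kappa>
        * poly (rodrigues_poly (real m + \<rho>) (\<kappa> + real m) m) ((cmod z)\<^sup>2))"
    unfolding zernike_def wirtinger_power_Rodrigues[OF assms(1,2) z1]
    by simp
  also have "local_power z (- \<rho>) z * local_power z \<rho> z = 1"
    using assms by (simp add: local_power_self_add) (simp add: local_power_def)
  also have "(1 - (cmod z)\<^sup>2) powr (- \<kappa>) * (1 - (cmod z)\<^sup>2) powr \<kappa> = 1"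
    using t by (simp flip: powr_add)
  finally show ?thesis by (simp add: zernike_poly_def)
qed

lemma zernike_gen_eq_poly:
  assumes "z \<noteq> 0" "cmod z < 1"
  shows "zernike_gen \<kappa> \<rho> s m z
    = sgn z powi s * of_real (poly (zernike_poly \<kappa> \<rho> m) ((cmod z)\<^sup>2))"
proof -
  have "sgn z powi s = (z / of_real (cmod z)) powi s"
    by (simp add: sgn_eq)
  also have "\<dots> = z powi s * of_real (cmod z powr (- of_int s))"
    using assms(1)
    by (simp add: power_int_divide_distrib powr_minus powr_real_of_int' field_simps
        of_real_power_int)
  finally show ?thesis
    using zernike_gen_eq[OF assms(1), of \<kappa> \<rho> s m] zernike_eq_poly[OF assms] by simp
qed

section \<open>The weighted measure on the disc\<close>

lemma space_zernike_measure [simp]: "space (zernike_measure \<kappa> \<rho>) = ball 0 1"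
  by (simp add: zernike_measure_def space_restrict_space)

lemma sets_zernike_measure: "sets (zernike_measure \<kappa> \<rho>) = (\<inter>) (ball 0 1) ` sets borel"
  by (simp add: zernike_measure_def sets_restrict_space)

lemma borel_measurable_zernike_measure:
  assumes "f \<in> borel_measurable borel"
  shows "f \<in> borel_measurable (zernike_measure \<kappa> \<rho>)"
  using assms by (simp add: zernike_measure_def measurable_restrict_space1)

definition zernike_weight :: "real \<Rightarrow> real \<Rightarrow> complex \<Rightarrow> real" where
  "zernike_weight \<kappa> \<rho> z = (1 - (cmod z)\<^sup>2) powr \<kappa> * cmod z powr (2 * \<rho>)"

lemma borel_measurable_zernike_weight [measurable]: "zernike_weight \<kappa> \<rho> \<in> borel_measurable borel"
  unfolding zernike_weight_def[abs_def] by measurable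

lemma zernike_weight_nonneg [simp]: "0 \<le> zernike_weight \<kappa> \<rho> z"
  by (simp add: zernike_weight_def)

lemma zernike_measure_eq_density:
  "zernike_measure \<kappa> \<rho> =
    density (restrict_space lborel (ball 0 1)) (\<lambda>z. ennreal (zernike_weight \<kappa> \<rho> z))"
  by (simp add: zernike_measure_def zernike_weight_def)

lemma zernike_weight_measurable_restrict:
  "zernike_weight \<kappa> \<rho> \<in> borel_measurable (restrict_space lborel (ball 0 1))"
  by (rule measurable_restrict_space1) simp

lemma AE_zernike_measure_nonzero: "AE z in zernike_measure \<kappa> \<rho>. z \<noteq> 0"
proof -
  have "AE z in restrict_space lborel (ball 0 1). z \<noteq> (0::complex)"
    using AE_lborel_singleton[of "0::complex"]
    by (subst AE_restrict_space_iff) (auto elim: eventually_mono)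
  then show ?thesis
    unfolding zernike_measure_eq_density
    by (subst AE_density) (auto simp: zernike_weight_measurable_restrict elim: eventually_mono)
qed

text \<open>
  In the variable \<open>t = \<bar>z\<bar>\<^sup>2\<close> the total mass is \<open>\<pi> \<integral>\<^sub>0\<^sup>1 (1 - t)\<^sup>\<kappa> t\<^sup>\<rho> dt\<close>, a Beta integral.
\<close>

lemma finite_measure_zernike_measure:
  assumes "\<kappa> > -1" "\<rho> > -1"
  shows "finite_measure (zernike_measure \<kappa> \<rho>)"
proof
  define g where "g t = ennreal ((1 - t) powr \<kappa> * t powr \<rho>) * indicator {..<1} t" for t :: real
  have [measurable]: "g \<in> borel_measurable borel" unfolding g_def[abs_def] by measurable
  have g: "ennreal (zernike_weight \<kappa> \<rho> z) * indicator (ball 0 1) z = g ((cmod z)\<^sup>2)" for z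
  proof -
    have "(cmod z)\<^sup>2 powr \<rho> = cmod z powr (2 * \<rho>)"
      by (cases "z = 0") (simp_all add: powr_powr flip: powr_numeral)
    moreover have "(cmod z)\<^sup>2 < 1 \<longleftrightarrow> cmod z < 1"
      by (simp add: power_less_one_iff abs_square_less_1)
    ultimately show ?thesis
      by (simp add: g_def zernike_weight_def indicator_def)
  qed
  have "emeasure (zernike_measure \<kappa> \<rho>) (space (zernike_measure \<kappa> \<rho>))
      = (\<integral>\<^sup>+z. ennreal (zernike_weight \<kappa> \<rho> z) * indicator (ball 0 1) z
          \<partial>restrict_space lborel (ball 0 1))"
    unfolding space_zernike_measure unfolding zernike_measure_eq_density
    by (rule emeasure_density)
      (auto simp: zernike_weight_measurable_restrict sets_restrict_space)
  also have "\<dots> = (\<integral>\<^sup>+z. ennreal (zernike_weight \<kappa> \<rho> z) * indicator (ball 0 1) z \<partial>lborel)"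
    by (subst nn_integral_restrict_space) (auto intro!: nn_integral_cong simp: indicator_def)
  also have "\<dots> = (\<integral>\<^sup>+z. g ((cmod z)\<^sup>2) \<partial>lborel)"
    by (simp only: g)
  also have "\<dots> = ennreal pi * (\<integral>\<^sup>+t. g t * indicator {0..} t \<partial>lborel)"
    by (rule nn_integral_radial) measurable
  finally have mass: "emeasure (zernike_measure \<kappa> \<rho>) (space (zernike_measure \<kappa> \<rho>))
      = ennreal pi * (\<integral>\<^sup>+t. g t * indicator {0..} t \<partial>lborel)" .
  have "(\<integral>\<^sup>+t. g t * indicator {0..} t \<partial>lborel)
      \<le> (\<integral>\<^sup>+t. ennreal (norm (indicator {0..1} t *\<^sub>R (t powr (\<rho> + 1 - 1) * (1 - t) powr (\<kappa> + 1 - 1)))) \<partial>lborel)"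
    by (intro nn_integral_mono) (auto simp: g_def indicator_def mult.commute)
  also have "\<dots> < \<infinity>"
  proof -
    have "set_integrable lborel {0..1} (\<lambda>t. t powr (\<rho> + 1 - 1) * (1 - t) powr (\<kappa> + 1 - 1))"
      by (rule integrable_Beta) (use assms in auto)
    then show ?thesis
      unfolding set_integrable_def by (simp add: integrable_iff_bounded)
  qed
  finally show "emeasure (zernike_measure \<kappa> \<rho>) (space (zernike_measure \<kappa> \<rho>)) \<noteq> \<infinity>"
    unfolding mass by (simp add: ennreal_mult_eq_top_iff)
qed

lemma integral_zernike_measure:
  fixes f :: "complex \<Rightarrow> complex"
  assumes f: "f \<in> borel_measurable borel"
  shows "(\<integral>z. f z \<partial>zernike_measure \<kappa> \<rho>) =
    (\<integral>z. indicator (ball 0 1) z *\<^sub>R (zernike_weight \<kappa> \<rho> z *\<^sub>R f z) \<partial>lborel)"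
proof -
  have "(\<integral>z. f z \<partial>zernike_measure \<kappa> \<rho>)
      = (\<integral>z. zernike_weight \<kappa> \<rho> z *\<^sub>R f z \<partial>restrict_space lborel (ball 0 1))"
    unfolding zernike_measure_eq_density
    by (rule integral_density)
      (use f in \<open>auto simp: zernike_weight_measurable_restrict measurable_restrict_space1\<close>)
  also have "\<dots> = (\<integral>z. indicator (ball 0 1) z *\<^sub>R (zernike_weight \<kappa> \<rho> z *\<^sub>R f z) \<partial>lborel)"
    by (rule integral_restrict_space) simp
  finally show ?thesis .
qed

lemma integral_zernike_measure_rotation:
  fixes f :: "complex \<Rightarrow> complex"
  assumes f[measurable]: "f \<in> borel_measurable borel" and \<omega>: "cmod \<omega> = 1"
  shows "(\<integral>z. f (\<omega> * z) \<partial>zernike_measure \<kappa> \<rho>) = (\<integral>z. f z \<partial>zernike_measure \<kappa> \<rho>)"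
proof -
  define h where "h z = indicator (ball 0 1) z *\<^sub>R (zernike_weight \<kappa> \<rho> z *\<^sub>R f z)" for z
  have [measurable]: "ball 0 1 \<in> sets (borel :: complex measure)" by simp
  have [measurable]: "h \<in> borel_measurable borel" unfolding h_def[abs_def] by measurable
  have "(\<integral>z. h z \<partial>lborel) = (\<integral>z. h z \<partial>distr lborel borel ((*) \<omega>))"
    by (simp add: lborel_distr_rotation[OF \<omega>])
  also have "\<dots> = (\<integral>z. h (\<omega> * z) \<partial>lborel)"
    by (rule integral_distr) measurable
  also have "\<dots> = (\<integral>z. indicator (ball 0 1) z *\<^sub>R (zernike_weight \<kappa> \<rho> z *\<^sub>R f (\<omega> * z)) \<partial>lborel)"
    by (intro Bochner_Integration.integral_cong)
      (auto simp: h_def zernike_weight_def norm_mult \<omega> indicator_def)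
  finally show ?thesis
    unfolding h_def by (subst (1 2) integral_zernike_measure) (auto intro: measurable_compose[OF _ f])
qed

section \<open>Angular modes\<close>

lemma continuous_on_compact_abs_bound:
  fixes f :: "'a::topological_space \<Rightarrow> real"
  assumes "compact S" "continuous_on S f"
  obtains B where "\<And>x. x \<in> S \<Longrightarrow> \<bar>f x\<bar> \<le> B"
proof -
  have "bounded (f ` S)"
    by (intro compact_imp_bounded compact_continuous_image assms)
  then show ?thesis using that unfolding bounded_iff by auto
qed

text \<open>
  In polar coordinates this is \<open>e\<^sup>i\<^sup>s\<^sup>\<theta> c(r\<^sup>2)\<close>. The value at \<open>0\<close> is \<open>0\<close> unless \<open>s = 0\<close>.
\<close>

definition angular_mode :: "int \<Rightarrow> (real \<Rightarrow> real) \<Rightarrow> complex \<Rightarrow> complex" where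
  "angular_mode s c z = sgn z powi s * of_real (c ((cmod z)\<^sup>2))"

lemma borel_measurable_angular_mode:
  assumes "continuous_on UNIV c"
  shows "angular_mode s c \<in> borel_measurable borel"
proof -
  have [measurable]: "c \<in> borel_measurable borel"
    by (rule borel_measurable_continuous_onI[OF assms])
  have [measurable]: "(sgn :: complex \<Rightarrow> complex) \<in> borel_measurable borel"
    unfolding sgn_div_norm[abs_def] by measurable
  show ?thesis
    unfolding angular_mode_def[abs_def] power_int_def by measurable
qed

lemma cmod_angular_mode_le: "cmod (angular_mode s c z) \<le> \<bar>c ((cmod z)\<^sup>2)\<bar>"
proof -
  have "cmod (sgn z powi s) \<le> 1"
    by (cases "z = 0") (auto simp: norm_power_int norm_sgn power_int_0_left_if)
  then show ?thesis
    by (simp add: angular_mode_def norm_mult mult_left_le_one_le)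
qed

lemma angular_mode_l2:
  assumes "\<kappa> > -1" "\<rho> > -1" and c: "continuous_on UNIV c"
  shows "angular_mode s c \<in> l2_space (zernike_measure \<kappa> \<rho>)"
proof -
  interpret finite_measure "zernike_measure \<kappa> \<rho>"
    by (rule finite_measure_zernike_measure) fact+
  obtain B where B: "\<And>t. t \<in> {0..1} \<Longrightarrow> \<bar>c t\<bar> \<le> B"
    using continuous_on_compact_abs_bound[OF compact_Icc continuous_on_subset[OF c]] by blast
  show ?thesis
  proof (rule l2_spaceI_bound)
    show "AE z in zernike_measure \<kappa> \<rho>. (cmod (angular_mode s c z))\<^sup>2 \<le> B\<^sup>2"
    proof (rule AE_I2)
      fix z assume "z \<in> space (zernike_measure \<kappa> \<rho>)"
      then have "(cmod z)\<^sup>2 \<in> {0..1}" by (simp add: power_le_one)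
      then show "(cmod (angular_mode s c z))\<^sup>2 \<le> B\<^sup>2"
        using B cmod_angular_mode_le[of s c z] by (intro power_mono) (auto intro: order_trans)
    qed
  qed (auto intro: borel_measurable_zernike_measure borel_measurable_angular_mode[OF c])
qed

lemma angular_mode_rotation:
  assumes "cmod \<omega> = 1"
  shows "angular_mode s c (\<omega> * z) = \<omega> powi s * angular_mode s c z"
proof -
  have "sgn \<omega> = \<omega>" using assms by (simp add: sgn_div_norm)
  then show ?thesis
    using assms by (simp add: angular_mode_def sgn_mult power_int_mult_distrib norm_mult)
qed

text \<open>
  Under the rotation by \<open>\<pi> / (s - t)\<close> the integrand of the inner product changes its sign, while
  the measure is invariant.
\<close>

lemma angular_modes_orthogonal:
  assumes c: "continuous_on UNIV c" and d: "continuous_on UNIV d" and st: "s \<noteq> t"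
  shows "l2_inner (zernike_measure \<kappa> \<rho>) (angular_mode s c) (angular_mode t d) = 0"
proof -
  define \<theta> where "\<theta> = pi / of_int (s - t)"
  define \<omega> where "\<omega> = cis \<theta>"
  define f where "f z = angular_mode s c z * cnj (angular_mode t d z)" for z
  have f: "f \<in> borel_measurable borel"
    unfolding f_def using borel_measurable_angular_mode[OF c] borel_measurable_angular_mode[OF d]
    by measurable
  have \<omega>: "cmod \<omega> = 1" by (simp add: \<omega>_def)
  have "of_int s * \<theta> + - (of_int t * \<theta>) = of_int (s - t) * \<theta>"
    by (simp add: algebra_simps)
  also have "\<dots> = pi" using st by (simp add: \<theta>_def)
  finally have "\<omega> powi s * cnj (\<omega> powi t) = -1"
    unfolding \<omega>_def cis_power_int cis_cnj cis_mult by simp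
  then have factor: "\<omega> powi s * cnj (\<omega> powi t) * f z = - f z" for z
    by (simp only: mult_minus_left mult_1)
  have "f (\<omega> * z) = \<omega> powi s * cnj (\<omega> powi t) * f z" for z
    unfolding f_def angular_mode_rotation[OF \<omega>] complex_cnj_mult by (simp only: mult_ac)
  then have "f (\<omega> * z) = - f z" for z
    by (simp only: factor)
  then have "(\<integral>z. f z \<partial>zernike_measure \<kappa> \<rho>) = - (\<integral>z. f z \<partial>zernike_measure \<kappa> \<rho>)"
    using integral_zernike_measure_rotation[OF f \<omega>, of \<kappa> \<rho>] by simp
  then show ?thesis by (simp add: l2_inner_def f_def)
qed

section \<open>The summands\<close>

lemma zernike_gen_eq_angular_mode:
  assumes "z \<in> ball 0 1" "z \<noteq> 0"
  shows "zernike_gen \<kappa> \<rho> s m z = angular_mode s (poly (zernike_poly \<kappa> \<rho> m)) z"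
  using assms by (simp add: zernike_gen_eq_poly angular_mode_def)

lemma AE_zernike_gen_eq:
  "AE z in zernike_measure \<kappa> \<rho>. zernike_gen \<kappa> \<rho> s m z = angular_mode s (poly (zernike_poly \<kappa> \<rho> m)) z"
proof -
  have "AE z in zernike_measure \<kappa> \<rho>. z \<in> ball 0 1"
    by (rule AE_I2) simp
  with AE_zernike_measure_nonzero show ?thesis
    by eventually_elim (simp add: zernike_gen_eq_angular_mode)
qed

lemma borel_measurable_zernike_gen:
  "zernike_gen \<kappa> \<rho> s m \<in> borel_measurable (zernike_measure \<kappa> \<rho>)"
proof -
  define f where "f z = (if z = 0 then zernike_gen \<kappa> \<rho> s m 0
      else angular_mode s (poly (zernike_poly \<kappa> \<rho> m)) z)" for z
  have [measurable]: "angular_mode s (poly (zernike_poly \<kappa> \<rho> m)) \<in> borel_measurable borel"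
    by (intro borel_measurable_angular_mode continuous_intros)
  have "f \<in> borel_measurable borel" unfolding f_def[abs_def] by measurable
  then have "f \<in> borel_measurable (zernike_measure \<kappa> \<rho>)"
    by (rule borel_measurable_zernike_measure)
  moreover have "f z = zernike_gen \<kappa> \<rho> s m z" if "z \<in> space (zernike_measure \<kappa> \<rho>)" for z
    using that by (simp add: f_def zernike_gen_eq_angular_mode)
  ultimately show ?thesis using measurable_cong by blast
qed

lemma continuous_on_poly_UNIV: "continuous_on UNIV (poly p)" for p :: "real poly"
  by (intro continuous_intros)

lemma zernike_gen_l2:
  assumes "\<kappa> > -1" "\<rho> > -1"
  shows "zernike_gen \<kappa> \<rho> s m \<in> l2_space (zernike_measure \<kappa> \<rho>)"
proof (rule l2_space_AE_cong)
  show "angular_mode s (poly (zernike_poly \<kappa> \<rho> m)) \<in> l2_space (zernike_measure \<kappa> \<rho>)"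
    by (intro angular_mode_l2 assms continuous_on_poly_UNIV)
qed (use AE_zernike_gen_eq[of \<kappa> \<rho> s m] in
  \<open>auto simp: borel_measurable_zernike_gen elim: eventually_mono\<close>)

lemma zernike_subspace_closed: "l2_closed_subspace (zernike_measure \<kappa> \<rho>) (zernike_subspace \<kappa> \<rho> s)"
  unfolding zernike_subspace_def by (rule l2_closed_subspace_closure[OF cfun.subspace_span])

lemma zernike_subspaces_orthogonal:
  assumes "\<kappa> > -1" "\<rho> > -1" "s \<noteq> t"
    and "f \<in> zernike_subspace \<kappa> \<rho> s" "g \<in> zernike_subspace \<kappa> \<rho> t"
  shows "l2_inner (zernike_measure \<kappa> \<rho>) f g = 0"
proof (rule l2_orthogonal_closed_spans[OF _ _ _ assms(4,5)[unfolded zernike_subspace_def]])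
  fix f g assume "f \<in> range (zernike_gen \<kappa> \<rho> s)" "g \<in> range (zernike_gen \<kappa> \<rho> t)"
  then obtain m n where fg: "f = zernike_gen \<kappa> \<rho> s m" "g = zernike_gen \<kappa> \<rho> t n" by auto
  let ?f = "angular_mode s (poly (zernike_poly \<kappa> \<rho> m))"
  let ?g = "angular_mode t (poly (zernike_poly \<kappa> \<rho> n))"
  have [measurable]: "f \<in> borel_measurable (zernike_measure \<kappa> \<rho>)" "g \<in> borel_measurable (zernike_measure \<kappa> \<rho>)"
      "?f \<in> borel_measurable (zernike_measure \<kappa> \<rho>)" "?g \<in> borel_measurable (zernike_measure \<kappa> \<rho>)"
    unfolding fg
    by (auto intro: borel_measurable_zernike_gen borel_measurable_zernike_measure
        borel_measurable_angular_mode continuous_on_poly_UNIV)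
  have "l2_inner (zernike_measure \<kappa> \<rho>) f g = l2_inner (zernike_measure \<kappa> \<rho>) ?f ?g"
    unfolding l2_inner_def
  proof (rule integral_cong_AE)
    show "AE z in zernike_measure \<kappa> \<rho>. f z * cnj (g z) = ?f z * cnj (?g z)"
      using AE_zernike_gen_eq[of \<kappa> \<rho> s m] AE_zernike_gen_eq[of \<kappa> \<rho> t n]
      unfolding fg by eventually_elim simp
  qed measurable
  also have "\<dots> = 0"
    by (rule angular_modes_orthogonal[OF continuous_on_poly_UNIV continuous_on_poly_UNIV assms(3)])
  finally show "l2_inner (zernike_measure \<kappa> \<rho>) f g = 0" .
qed (use zernike_gen_l2[OF assms(1,2)] in auto)

text \<open>
  The polynomials \<open>zernike_poly \<kappa> \<rho> m\<close> have degree \<open>m\<close>, so subtracting a multiple of one of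
  them cancels the leading coefficient of a given polynomial.
\<close>

lemma angular_mode_poly_in_subspace:
  assumes "\<kappa> > -1" "\<rho> > -1"
  shows "angular_mode s (poly p) \<in> zernike_subspace \<kappa> \<rho> s"
proof -
  note closed = zernike_subspace_closed[of \<kappa> \<rho> s]
  note sub = l2_closed_subspaceD(1)[OF closed]
  have gen: "angular_mode s (poly (zernike_poly \<kappa> \<rho> m)) \<in> zernike_subspace \<kappa> \<rho> s" for m
  proof (rule l2_closed_AE_cong[OF closed _ _ AE_zernike_gen_eq])
    have "zernike_gen \<kappa> \<rho> s m \<in> cfun.span (range (zernike_gen \<kappa> \<rho> s)) \<inter> l2_space (zernike_measure \<kappa> \<rho>)"
      using zernike_gen_l2[OF assms] by (auto intro: cfun.span_base)
    then show "zernike_gen \<kappa> \<rho> s m \<in> zernike_subspace \<kappa> \<rho> s"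
      unfolding zernike_subspace_def using subset_l2_closure by blast
    show "angular_mode s (poly (zernike_poly \<kappa> \<rho> m)) \<in> borel_measurable (zernike_measure \<kappa> \<rho>)"
      by (intro borel_measurable_zernike_measure borel_measurable_angular_mode continuous_on_poly_UNIV)
  qed
  have "angular_mode s (poly p) \<in> zernike_subspace \<kappa> \<rho> s" if "\<forall>j\<ge>n. coeff p j = 0" for n p
    using that
  proof (induction n arbitrary: p)
    case 0
    then have "p = 0" by (simp add: poly_eq_iff)
    then have "angular_mode s (poly p) = 0" by (simp add: fun_eq_iff angular_mode_def)
    then show ?case by (simp only: cfun.subspace_0[OF sub])
  next
    case (Suc n)
    define z where "z = zernike_poly \<kappa> \<rho> n"
    define a where "a = coeff p n / coeff z n"
    have deg: "degree z = n" unfolding z_def by (rule degree_zernike_poly[OF assms])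
    have lead: "coeff z n \<noteq> 0"
    proof (cases n)
      case 0
      then show ?thesis by (simp add: z_def zernike_poly_def)
    next
      case (Suc k)
      then show ?thesis using deg by (metis leading_coeff_neq_0 degree_0 nat.distinct(1))
    qed
    have "coeff (p - smult a z) j = 0" if "j \<ge> n" for j
    proof (cases "j = n")
      case True
      then show ?thesis using lead by (simp add: a_def)
    next
      case False
      then show ?thesis using that Suc.prems deg by (simp add: coeff_eq_0)
    qed
    then have "angular_mode s (poly (p - smult a z)) \<in> zernike_subspace \<kappa> \<rho> s"
      by (intro Suc.IH) auto
    then have "angular_mode s (poly (p - smult a z)) + fun_scale (of_real a) (angular_mode s (poly z))
        \<in> zernike_subspace \<kappa> \<rho> s"
      using gen[of n] unfolding z_def by (intro cfun.subspace_add[OF sub] cfun.subspace_scale[OF sub])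
    moreover have "angular_mode s (poly (p - smult a z)) + fun_scale (of_real a) (angular_mode s (poly z))
        = angular_mode s (poly p)"
      by (simp add: fun_eq_iff angular_mode_def fun_scale_def algebra_simps)
    ultimately show ?case by simp
  qed
  then show ?thesis using coeff_eq_0[of p] by (metis Suc_le_eq)
qed

text \<open>
  Polynomial approximation of \<open>c\<close> on \<open>[0, 1]\<close>.
\<close>

lemma angular_mode_continuous_in_subspace:
  assumes "\<kappa> > -1" "\<rho> > -1" and c: "continuous_on UNIV c"
  shows "angular_mode s c \<in> zernike_subspace \<kappa> \<rho> s"
proof -
  interpret finite_measure "zernike_measure \<kappa> \<rho>"
    by (rule finite_measure_zernike_measure) fact+
  have c01: "continuous_on {0..1} c" by (rule continuous_on_subset[OF c]) simp
  obtain B where B: "\<And>t. t \<in> {0..1} \<Longrightarrow> \<bar>c t\<bar> \<le> B"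
    using continuous_on_compact_abs_bound[OF compact_Icc c01] by blast
  have "\<exists>p. \<forall>t\<in>{0..1}. \<bar>c t - poly p t\<bar> < inverse (real (Suc n))" for n
  proof -
    obtain g where g: "real_polynomial_function g" "\<And>t. t \<in> {0..1} \<Longrightarrow> \<bar>c t - g t\<bar> < inverse (real (Suc n))"
      using Stone_Weierstrass_real_polynomial_function[OF compact_Icc c01, of "inverse (real (Suc n))"]
      by auto
    obtain a N where "g = (\<lambda>t. \<Sum>i\<le>N. a i * t ^ i)"
      using g(1) unfolding real_polynomial_function_iff_sum by blast
    then have "g t = poly (\<Sum>i\<le>N. monom (a i) i) t" for t
      by (simp add: poly_sum poly_monom)
    then show ?thesis using g(2) by metis
  qed
  then obtain p where p: "\<And>n t. t \<in> {0..1} \<Longrightarrow> \<bar>c t - poly (p n) t\<bar> < inverse (real (Suc n))"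
    by metis
  show ?thesis
  proof (rule l2_closed_dominated_limit[OF zernike_subspace_closed])
    show "angular_mode s (poly (p n)) \<in> zernike_subspace \<kappa> \<rho> s" for n
      by (rule angular_mode_poly_in_subspace) fact+
    show "angular_mode s c \<in> borel_measurable (zernike_measure \<kappa> \<rho>)"
      by (intro borel_measurable_zernike_measure borel_measurable_angular_mode c)
    fix z assume "z \<in> space (zernike_measure \<kappa> \<rho>)"
    then have t: "(cmod z)\<^sup>2 \<in> {0..1}" by (simp add: power_le_one)
    have "(\<lambda>n. poly (p n) ((cmod z)\<^sup>2) - c ((cmod z)\<^sup>2)) \<longlonglongrightarrow> 0"
      by (rule Lim_null_comparison[OF _ LIMSEQ_inverse_real_of_nat])
        (use p[OF t] in \<open>auto simp: abs_minus_commute less_imp_le simp del: of_nat_Suc\<close>)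
    then have "(\<lambda>n. poly (p n) ((cmod z)\<^sup>2)) \<longlonglongrightarrow> c ((cmod z)\<^sup>2)"
      by (simp add: LIM_zero_iff)
    then show "(\<lambda>n. angular_mode s (poly (p n)) z) \<longlonglongrightarrow> angular_mode s c z"
      unfolding angular_mode_def by (intro tendsto_intros)
    show "cmod (angular_mode s (poly (p n)) z) \<le> B + 1" for n
    proof -
      have "inverse (real (Suc n)) \<le> 1" by (simp add: inverse_le_1_iff)
      then have "\<bar>poly (p n) ((cmod z)\<^sup>2)\<bar> \<le> B + 1"
        using p[OF t, of n] B[OF t] by linarith
      then show ?thesis using cmod_angular_mode_le[of s "poly (p n)" z] by linarith
    qed
  qed simp
qed

section \<open>Totality\<close>

definition angular_span :: "(complex \<Rightarrow> complex) set" where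
  "angular_span = cfun.span {angular_mode s c | s c. continuous_on UNIV c}"

lemma subspace_angular_span: "cfun.subspace angular_span"
  unfolding angular_span_def by (rule cfun.subspace_span)

lemma angular_mode_in_angular_span:
  assumes "continuous_on UNIV c"
  shows "angular_mode s c \<in> angular_span"
  unfolding angular_span_def using assms by (intro cfun.span_base) auto

lemma angular_span_minimal:
  assumes "cfun.subspace T" "\<And>s c. continuous_on UNIV c \<Longrightarrow> angular_mode s c \<in> T"
  shows "angular_span \<subseteq> T"
  unfolding angular_span_def using assms by (intro cfun.span_minimal) auto

text \<open>
  The product of two modes is a mode except at \<open>0\<close>, where \<open>sgn 0 powi s\<close> is not multiplicative
  in \<open>s\<close>.
\<close>

lemma angular_span_mult:
  assumes "f \<in> angular_span" "g \<in> angular_span"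
  shows "\<exists>h\<in>angular_span. \<forall>z. z \<noteq> 0 \<longrightarrow> h z = f z * g z"
proof -
  note sub = subspace_angular_span
  have subspace: "cfun.subspace {f. \<exists>h\<in>angular_span. \<forall>z. z \<noteq> 0 \<longrightarrow> h z = f z * g z}" for g
  proof (rule cfun.subspaceI)
    show "0 \<in> {f. \<exists>h\<in>angular_span. \<forall>z. z \<noteq> 0 \<longrightarrow> h z = f z * g z}"
      by (auto intro!: bexI[OF _ cfun.subspace_0[OF sub]])
  next
    fix f1 f2
    assume "f1 \<in> {f. \<exists>h\<in>angular_span. \<forall>z. z \<noteq> 0 \<longrightarrow> h z = f z * g z}"
      and "f2 \<in> {f. \<exists>h\<in>angular_span. \<forall>z. z \<noteq> 0 \<longrightarrow> h z = f z * g z}"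
    then obtain h1 h2 where "h1 \<in> angular_span" "h2 \<in> angular_span"
      "\<forall>z. z \<noteq> 0 \<longrightarrow> h1 z = f1 z * g z" "\<forall>z. z \<noteq> 0 \<longrightarrow> h2 z = f2 z * g z" by auto
    then show "f1 + f2 \<in> {f. \<exists>h\<in>angular_span. \<forall>z. z \<noteq> 0 \<longrightarrow> h z = f z * g z}"
      by (auto intro!: bexI[OF _ cfun.subspace_add[OF sub, of h1 h2]] simp: distrib_right)
  next
    fix c f1
    assume "f1 \<in> {f. \<exists>h\<in>angular_span. \<forall>z. z \<noteq> 0 \<longrightarrow> h z = f z * g z}"
    then obtain h1 where "h1 \<in> angular_span" "\<forall>z. z \<noteq> 0 \<longrightarrow> h1 z = f1 z * g z" by auto
    then show "fun_scale c f1 \<in> {f. \<exists>h\<in>angular_span. \<forall>z. z \<noteq> 0 \<longrightarrow> h z = f z * g z}"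
      by (auto intro!: bexI[OF _ cfun.subspace_scale[OF sub, of h1 c]] simp: fun_scale_def)
  qed
  have modes: "\<exists>h\<in>angular_span. \<forall>z. z \<noteq> 0 \<longrightarrow> h z = angular_mode s c z * angular_mode t d z"
    if "continuous_on UNIV c" "continuous_on UNIV d" for s t c d
  proof
    show "angular_mode (s + t) (\<lambda>x. c x * d x) \<in> angular_span"
      using that by (intro angular_mode_in_angular_span continuous_intros)
    show "\<forall>z. z \<noteq> 0 \<longrightarrow> angular_mode (s + t) (\<lambda>x. c x * d x) z = angular_mode s c z * angular_mode t d z"
      by (simp add: angular_mode_def power_int_add sgn_zero_iff)
  qed
  have one: "\<exists>h\<in>angular_span. \<forall>z. z \<noteq> 0 \<longrightarrow> h z = f z * angular_mode t d z"
    if f: "f \<in> angular_span" and d: "continuous_on UNIV d" for f t d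
    using angular_span_minimal[OF subspace[of "angular_mode t d"]] modes[OF _ d] f by blast
  have "\<exists>h\<in>angular_span. \<forall>z. z \<noteq> 0 \<longrightarrow> h z = angular_mode t d z * f z"
    if "continuous_on UNIV d" for t d
    using one[OF assms(1) that] by (simp only: mult.commute)
  then have "\<exists>h\<in>angular_span. \<forall>z. z \<noteq> 0 \<longrightarrow> h z = g z * f z"
    using angular_span_minimal[OF subspace[of f]] assms(2) by blast
  then show ?thesis by (simp only: mult.commute)
qed

text \<open>
  A real linear form on the plane is \<open>a z + b \<zeta>\<close> with \<open>\<zeta>\<close> the conjugate of \<open>z\<close>; moreover \<open>z\<close> and \<open>\<zeta>\<close> are
  the modes with \<open>s = 1\<close>, \<open>s = -1\<close> and radial factor \<open>\<bar>z\<bar> = sqrt t\<close>.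
\<close>

lemma real_polynomial_in_angular_span:
  assumes "real_polynomial_function p"
  shows "\<exists>h\<in>angular_span. \<forall>z. z \<noteq> 0 \<longrightarrow> h z = of_real (p z)"
proof -
  note sub = subspace_angular_span
  note mode = angular_mode_in_angular_span
  from assms show ?thesis
  proof (induction rule: real_polynomial_function.induct)
    case (linear f)
    interpret bounded_linear f by fact
    define a b where "a = (of_real (f 1) - \<i> * of_real (f \<i>)) / 2"
      and "b = (of_real (f 1) + \<i> * of_real (f \<i>)) / 2"
    define h where "h = fun_scale a (angular_mode 1 sqrt) + fun_scale b (angular_mode (-1) sqrt)"
    have "h \<in> angular_span"
      unfolding h_def
      by (intro cfun.subspace_add[OF sub] cfun.subspace_scale[OF sub] mode continuous_intros)
    moreover have "h z = of_real (f z)" if "z \<noteq> 0" for z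
    proof -
      have "sgn z * of_real (cmod z) = z" using that by (simp add: sgn_eq)
      moreover have "inverse (sgn z) * of_real (cmod z) = cnj z"
        using that complex_norm_square[of z]
        by (simp add: sgn_eq field_simps power2_eq_square)
      ultimately have "h z = a * z + b * cnj z"
        by (simp add: h_def angular_mode_def fun_scale_def power_int_minus)
      also have "\<dots> = of_real (Re z * f 1 + Im z * f \<i>)"
        by (simp add: a_def b_def complex_eq_iff field_simps)
      also have "Re z * f 1 + Im z * f \<i> = f (Re z *\<^sub>R 1 + Im z *\<^sub>R \<i>)"
        by (simp only: add scaleR real_scaleR_def)
      also have "Re z *\<^sub>R 1 + Im z *\<^sub>R \<i> = z" by (simp add: complex_eq_iff)
      finally show ?thesis .
    qed
    ultimately show ?case by blast
  next
    case (const c)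
    have "angular_mode 0 (\<lambda>_. c) \<in> angular_span" by (intro mode continuous_intros)
    then show ?case by (rule bexI[rotated]) (simp add: angular_mode_def)
  next
    case (add f g)
    then obtain h1 h2 where "h1 \<in> angular_span" "h2 \<in> angular_span"
      "\<forall>z. z \<noteq> 0 \<longrightarrow> h1 z = of_real (f z)" "\<forall>z. z \<noteq> 0 \<longrightarrow> h2 z = of_real (g z)" by auto
    then show ?case
      by (intro bexI[OF _ cfun.subspace_add[OF sub, of h1 h2]]) auto
  next
    case (mult f g)
    then obtain h1 h2 where h: "h1 \<in> angular_span" "h2 \<in> angular_span"
      "\<forall>z. z \<noteq> 0 \<longrightarrow> h1 z = of_real (f z)" "\<forall>z. z \<noteq> 0 \<longrightarrow> h2 z = of_real (g z)" by auto
    from angular_span_mult[OF h(1,2)] h(3,4) show ?case by auto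
  qed
qed

text \<open>
  The closed span contains the real polynomials in two variables, thus the continuous functions by
  Stone--Weierstrass, thus the indicators of closed sets \<open>C\<close>, which are pointwise limits of
  \<open>max 0 (1 - n dist(z, C))\<close>. Closed sets generate the measurable ones.
\<close>

lemma zernike_subspaces_total:
  assumes "\<kappa> > -1" "\<rho> > -1"
  shows "l2_closure (zernike_measure \<kappa> \<rho>) (cfun.span (\<Union>s. zernike_subspace \<kappa> \<rho> s))
    = l2_space (zernike_measure \<kappa> \<rho>)" (is "?D = _")
proof -
  let ?M = "zernike_measure \<kappa> \<rho>"
  interpret finite_measure ?M by (rule finite_measure_zernike_measure) fact+
  have D: "l2_closed_subspace ?M ?D"
    by (rule l2_closed_subspace_closure[OF cfun.subspace_span])
  have "angular_mode s c \<in> ?D" if c: "continuous_on UNIV c" for s c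
  proof -
    have "angular_mode s c \<in> cfun.span (\<Union>s. zernike_subspace \<kappa> \<rho> s) \<inter> l2_space ?M"
      using angular_mode_continuous_in_subspace[OF assms c] angular_mode_l2[OF assms c]
      by (auto intro: cfun.span_base)
    then show ?thesis using subset_l2_closure by blast
  qed
  then have trig: "angular_span \<subseteq> ?D"
    by (intro angular_span_minimal l2_closed_subspaceD(1)[OF D])
  have poly: "(\<lambda>z. of_real (p z)) \<in> ?D" if p: "real_polynomial_function p" for p
  proof -
    obtain h where h: "h \<in> angular_span" "\<And>z. z \<noteq> 0 \<Longrightarrow> h z = of_real (p z)"
      using real_polynomial_in_angular_span[OF p] by blast
    show ?thesis
    proof (rule l2_closed_AE_cong[OF D])
      show "h \<in> ?D" using h trig by blast
      have [measurable]: "p \<in> borel_measurable borel"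
        using p by (intro borel_measurable_continuous_onI continuous_on_polymonial_function)
          (simp add: real_polynomial_function_eq)
      show "(\<lambda>z. complex_of_real (p z)) \<in> borel_measurable ?M"
        by (intro borel_measurable_zernike_measure) measurable
      show "AE z in ?M. h z = of_real (p z)"
        using AE_zernike_measure_nonzero by eventually_elim (rule h)
    qed
  qed
  have cont: "(\<lambda>z. of_real (g z)) \<in> ?D" if g: "continuous_on UNIV g" for g :: "complex \<Rightarrow> real"
  proof -
    have g': "continuous_on (cball 0 1) g" by (rule continuous_on_subset[OF g]) simp
    obtain B where B: "\<And>z. z \<in> cball 0 1 \<Longrightarrow> \<bar>g z\<bar> \<le> B"
      using continuous_on_compact_abs_bound[OF compact_cball g'] by blast
    have "\<exists>p. real_polynomial_function p \<and> (\<forall>z\<in>cball 0 1. \<bar>g z - p z\<bar> < inverse (real (Suc n)))" for n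
    proof -
      have "0 < inverse (real (Suc n))" by simp
      obtain q where "real_polynomial_function q"
        "\<And>z. z \<in> cball 0 1 \<Longrightarrow> \<bar>g z - q z\<bar> < inverse (real (Suc n))"
        by (rule Stone_Weierstrass_real_polynomial_function[OF compact_cball g'
              \<open>0 < inverse (real (Suc n))\<close>], rule that)
      then show ?thesis by (intro exI[of _ q] conjI ballI)
    qed
    then have "\<forall>n. \<exists>p. real_polynomial_function p \<and>
        (\<forall>z\<in>cball 0 1. \<bar>g z - p z\<bar> < inverse (real (Suc n)))" by (rule allI)
    from choice[OF this] obtain p where p': "\<forall>n. real_polynomial_function (p n) \<and>
        (\<forall>z\<in>cball 0 1. \<bar>g z - p n z\<bar> < inverse (real (Suc n)))" by (rule exE)
    then have p: "real_polynomial_function (p n)"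
        "z \<in> cball 0 1 \<Longrightarrow> \<bar>g z - p n z\<bar> < inverse (real (Suc n))" for n z
      by simp_all
    show ?thesis
    proof (rule l2_closed_dominated_limit[OF D])
      show "(\<lambda>z. of_real (p n z)) \<in> ?D" for n by (rule poly[OF p(1)])
      have [measurable]: "g \<in> borel_measurable borel" by (rule borel_measurable_continuous_onI[OF g])
      show "(\<lambda>z. complex_of_real (g z)) \<in> borel_measurable ?M"
        by (intro borel_measurable_zernike_measure) measurable
      fix z assume "z \<in> space ?M"
      then have z: "z \<in> cball 0 1" by simp
      have "(\<lambda>n. p n z - g z) \<longlonglongrightarrow> 0"
        by (rule Lim_null_comparison[OF _ LIMSEQ_inverse_real_of_nat])
          (use p(2)[OF z] in \<open>auto simp: abs_minus_commute less_imp_le simp del: of_nat_Suc\<close>)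
      then have "(\<lambda>n. p n z) \<longlonglongrightarrow> g z" by (simp add: LIM_zero_iff)
      then show "(\<lambda>n. of_real (p n z)) \<longlonglongrightarrow> (of_real (g z) :: complex)" by (rule tendsto_of_real)
      show "cmod (of_real (p n z)) \<le> B + 1" for n
      proof -
        have "inverse (real (Suc n)) \<le> 1" by (simp add: inverse_le_1_iff)
        then show ?thesis using p(2)[OF z, of n] B[OF z] by simp
      qed
    qed simp
  qed
  show ?thesis
  proof (rule l2_closed_eq_space_if_indicators[OF finite_measure_zernike_measure[OF assms] D])
    let ?G = "(\<inter>) (ball 0 1) ` {C :: complex set. closed C}"
    show "Int_stable ?G"
    proof (rule Int_stableI)
      fix a b assume "a \<in> ?G" "b \<in> ?G"
      then obtain C C' where "closed C" "closed C'" "a = ball 0 1 \<inter> C" "b = ball 0 1 \<inter> C'" by blast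
      then have "a \<inter> b = ball 0 1 \<inter> (C \<inter> C')" "closed (C \<inter> C')" by auto
      then show "a \<inter> b \<in> ?G" by blast
    qed
    show "?G \<subseteq> Pow (space ?M)" by auto
    have borel: "sets borel = sigma_sets UNIV {C :: complex set. closed C}"
      unfolding borel_eq_closed by (rule sets_measure_of) simp
    have "ball 0 1 \<in> sigma_sets UNIV {C :: complex set. closed C}"
      unfolding borel[symmetric] by simp
    from sigma_sets_Int[OF this subset_UNIV]
    show "sets ?M = sigma_sets (space ?M) ?G"
      by (simp only: sets_zernike_measure space_zernike_measure borel)
    have closed_ind: "(indicator (ball 0 1 \<inter> C) :: complex \<Rightarrow> complex) \<in> ?D" if C: "closed C" for C
    proof (cases "C = {}")
      case True
      then have "(indicator (ball 0 1 \<inter> C) :: complex \<Rightarrow> complex) = 0"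
        by (simp add: fun_eq_iff)
      then show ?thesis by (simp only: cfun.subspace_0[OF l2_closed_subspaceD(1)[OF D]])
    next
      case False
      define u :: "nat \<Rightarrow> complex \<Rightarrow> real" where "u n z = max 0 (1 - real n * infdist z C)" for n z
      have "continuous_on UNIV (u n)" for n
        unfolding u_def[abs_def] by (intro continuous_intros)
      then have u: "(\<lambda>z. of_real (u n z)) \<in> ?D" for n by (rule cont)
      show ?thesis
      proof (rule l2_closed_dominated_limit[OF D u])
        show "(indicator (ball 0 1 \<inter> C) :: complex \<Rightarrow> complex) \<in> borel_measurable ?M"
          using C by (intro borel_measurable_zernike_measure borel_measurable_indicator sets.Int) auto
        fix z assume "z \<in> space ?M"
        then have z: "z \<in> ball 0 1" by simp
        show "(\<lambda>n. complex_of_real (u n z)) \<longlonglongrightarrow> indicator (ball 0 1 \<inter> C) z"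
        proof (cases "z \<in> C")
          case True
          then show ?thesis using z by (simp add: u_def)
        next
          case outside: False
          then have "infdist z C > 0" using C False by (simp add: infdist_pos_not_in_closed)
          from ex_less_of_nat_mult[OF this, of 1]
          obtain N where N: "1 < real N * infdist z C" by (rule exE)
          have "u n z = 0" if "n \<ge> N" for n
          proof -
            have "real N * infdist z C \<le> real n * infdist z C"
              using that by (intro mult_right_mono) (auto simp: infdist_nonneg)
            then show ?thesis using N by (simp add: u_def)
          qed
          then have "eventually (\<lambda>n. complex_of_real (u n z) = indicator (ball 0 1 \<inter> C) z) sequentially"
            using outside by (auto simp: eventually_sequentially)
          then show ?thesis by (rule tendsto_eventually)
        qed
        show "cmod (of_real (u n z)) \<le> 1" for n
          by (simp add: u_def infdist_nonneg)
      qed simp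
    qed
    then show "(indicator X :: complex \<Rightarrow> complex) \<in> ?D" if "X \<in> ?G" for X
      using that by auto
    show "(indicator (space ?M) :: complex \<Rightarrow> complex) \<in> ?D"
      using closed_ind[of UNIV] by simp
  qed
qed

theorem corollary3p24:
  fixes \<kappa> \<rho> :: real
  assumes "\<kappa> > -1" and "\<rho> > -1" and "\<rho> \<notin> \<int>"
  shows "l2_orthogonal_decomposition (zernike_measure \<kappa> \<rho>) (UNIV :: int set)
    (zernike_subspace \<kappa> \<rho>)"
proof -
  interpret l2_orthogonal_family "zernike_measure \<kappa> \<rho>" "UNIV :: int set" "zernike_subspace \<kappa> \<rho>"
    by standard (use zernike_subspace_closed zernike_subspaces_orthogonal[OF assms(1,2)] in auto)
  show ?thesis
    by (rule orthogonal_decomposition_if_total) (rule zernike_subspaces_total[OF assms(1,2)])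
qed

end
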